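(* Let $A$ be a real $n\times n$ matrix whose eigenvalues are all real and positive, let $M=e^{A}$, and let $F:\mathbb{R}^n\to\mathbb{R}^n$ be a $Bilip_{D_M}$ map. Write points $u\in\mathbb{R}^n$ as $(\mathbf{x}_1,\ldots,\mathbf{x}_r)$ in the block coordinates with respect to the ordered basis $\mathcal{B}$. Then $F$ has the form $$F(u)=\bigl(f_1(\mathbf{x}_1,\ldots,\mathbf{x}_r),\,f_2(\mathbf{x}_2,\ldots,\mathbf{x}_r),\,\ldots,\,f_r(\mathbf{x}_r)\bigr),$$ that is, the $i$-th block coordinate of $F(u)$ depends only on $\mathbf{x}_i,\ldots,\mathbf{x}_r$. Furthermore, each $f_i$ is bilipschitz with respect to $\mathbf{x}_i$ (for the usual Euclidean metric) and continuous in the remaining coordinates.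
   Context: Ordered basis $\mathcal{B}$. For each eigenvalue $\alpha$ of $A$ let $V_\alpha$ be the generalized eigenspace and let $\{v_i^\alpha\}_i$ be generators of Jordan chains in $V_\alpha$, with lengths $n_i$, so $(A-\alpha I)^{n_i}v_i^\alpha=0$, $(A-\alpha I)^{n_i-1}v_i^\alpha\neq 0$, and $\mathcal{B}_\alpha=\bigcup_i\{(A-\alpha I)^{n_i-1}v_i^\alpha,\ldots,(A-\alpha I)v_i^\alpha,v_i^\alpha\}$ is a basis of $V_\alpha$. For $\ell\ge 1$ put $\mathcal{B}_{\alpha,\ell}=\mathcal{B}_\alpha\cap(\ker(A-\alpha I)^{\ell}\setminus\ker(A-\alpha I)^{\ell-1})$. Then $\mathcal{B}=\bigcup_{\alpha,\ell}\mathcal{B}_{\alpha,\ell}$ is a basis of $\mathbb{R}^n$. Order the pairs $(\alpha,\ell)$ with $\mathcal{B}_{\alpha,\ell}\ne\emptyset$ by $(\alpha,\ell)>(\beta,\iota)$ iff $\alpha>\beta$, or $\alpha=\beta$ and $\ell>\iota$. Let $\mathbf{x}_{\alpha,\ell}$ be the vector of coefficients of $u$ with respect to $\mathcal{B}_{\alpha,\ell}$. Numbering the pairs in ascending order $1,\ldots,r$, write $u=(\mathbf{x}_1,\ldots,\mathbf{x}_r)$ (so $\mathbf{x}_r$ corresponds to the largest pair). Boundary metric. Let $\|\cdot\|$ be the coordinate-wise max norm in the coordinates given by $\mathcal{B}$. For $p\ne q$ in $\mathbb{R}^n$, $D_M(p,q)=e^{t_0}$, where $t_0$ is the smallest $t\in\mathbb{R}$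 with $\|e^{-tA}(p-q)\|\le 1$; and $D_M(p,p)=0$. A map $F:\mathbb{R}^n\to\mathbb{R}^n$ is a $Bilip_{D_M}$ map if there is a constant $K$ with $\frac1K D_M(p,q)\le D_M(F(p),F(q))\le K D_M(p,q)$ for all $p,q\in\mathbb{R}^n$. *)

theory Defs
  imports "HOL-Analysis.Analysis"
begin

definition eigenvalue :: "'a::field^'n^'n \<Rightarrow> 'a \<Rightarrow> bool" where
  "eigenvalue A \<alpha> \<longleftrightarrow> (\<exists>v. v \<noteq> 0 \<and> A *v v = \<alpha> *s v)"

definition complexify :: "real^'n^'n \<Rightarrow> complex^'n^'n" where
  "complexify A = (\<chi> i j. complex_of_real (A $ i $ j))"

(* The library's product on real^'n^'n (and hence any power or exponential built from it) is
   entrywise, so powers and exponentials are defined here from the matrix product. *)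
primrec mat_pow :: "'a::semiring_1^'n^'n \<Rightarrow> nat \<Rightarrow> 'a^'n^'n" where
  "mat_pow A 0 = mat 1"
| "mat_pow A (Suc k) = A ** mat_pow A k"

definition mat_exp :: "real^'n^'n \<Rightarrow> real^'n^'n" where
  "mat_exp A = (\<Sum>k. (1 / fact k) *\<^sub>R mat_pow A k)"

definition ker_pow :: "real^'n^'n \<Rightarrow> real \<Rightarrow> nat \<Rightarrow> (real^'n) set" where
  "ker_pow A \<alpha> k = {u. mat_pow (A - mat \<alpha>) k *v u = 0}"

definition gen_eigenspace :: "real^'n^'n \<Rightarrow> real \<Rightarrow> (real^'n) set" where
  "gen_eigenspace A \<alpha> = (\<Union>k. ker_pow A \<alpha> k)"

(* A Jordan chain is recorded as a pair (v, m) of a generator and its length;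
   S \<alpha> is the set of the pairs chosen for the eigenvalue \<alpha>. *)
definition chain :: "real^'n^'n \<Rightarrow> real \<Rightarrow> (real^'n) \<times> nat \<Rightarrow> (real^'n) set" where
  "chain A \<alpha> = (\<lambda>(v, m). {mat_pow (A - mat \<alpha>) k *v v | k. k < m})"

definition jbasis_at ::
  "real^'n^'n \<Rightarrow> (real \<Rightarrow> ((real^'n) \<times> nat) set) \<Rightarrow> real \<Rightarrow> (real^'n) set" where
  "jbasis_at A S \<alpha> = (\<Union>c\<in>S \<alpha>. chain A \<alpha> c)"

(* Distinct chains have to be disjoint: the vectors of all the chains, taken as a family,
   form the basis, which a condition on their union alone would not express. *)
definition jordan_chains :: "real^'n^'n \<Rightarrow> (real \<Rightarrow> ((real^'n) \<times> nat) set) \<Rightarrow> bool" where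
  "jordan_chains A S \<longleftrightarrow> (\<forall>\<alpha>. eigenvalue A \<alpha> \<longrightarrow>
     (\<forall>(v, m)\<in>S \<alpha>. 1 \<le> m \<and> mat_pow (A - mat \<alpha>) m *v v = 0 \<and>
                    mat_pow (A - mat \<alpha>) (m - 1) *v v \<noteq> 0) \<and>
     disjoint_family_on (chain A \<alpha>) (S \<alpha>) \<and>
     independent (jbasis_at A S \<alpha>) \<and>
     span (jbasis_at A S \<alpha>) = gen_eigenspace A \<alpha>)"

definition jlevel ::
  "real^'n^'n \<Rightarrow> (real \<Rightarrow> ((real^'n) \<times> nat) set) \<Rightarrow> real \<times> nat \<Rightarrow> (real^'n) set" where
  "jlevel A S = (\<lambda>(\<alpha>, l). jbasis_at A S \<alpha> \<inter> (ker_pow A \<alpha> l - ker_pow A \<alpha> (l - 1)))"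

definition jpairs :: "real^'n^'n \<Rightarrow> (real \<Rightarrow> ((real^'n) \<times> nat) set) \<Rightarrow> (real \<times> nat) set" where
  "jpairs A S = {(\<alpha>, l). eigenvalue A \<alpha> \<and> 1 \<le> l \<and> jlevel A S (\<alpha>, l) \<noteq> {}}"

definition jbasis :: "real^'n^'n \<Rightarrow> (real \<Rightarrow> ((real^'n) \<times> nat) set) \<Rightarrow> (real^'n) set" where
  "jbasis A S = (\<Union>p\<in>jpairs A S. jlevel A S p)"

definition pair_less :: "real \<times> nat \<Rightarrow> real \<times> nat \<Rightarrow> bool" where
  "pair_less = (\<lambda>(\<beta>, k) (\<alpha>, l). \<beta> < \<alpha> \<or> (\<beta> = \<alpha> \<and> k < l))"

definition ascending_numbering :: "(real \<times> nat) set \<Rightarrow> nat \<Rightarrow> (nat \<Rightarrow> real \<times> nat) \<Rightarrow> bool" where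
  "ascending_numbering P r \<pi> \<longleftrightarrow>
     bij_betw \<pi> {1..r} P \<and> (\<forall>i\<in>{1..r}. \<forall>j\<in>{1..r}. i < j \<longrightarrow> pair_less (\<pi> i) (\<pi> j))"

(* For C \<subseteq> B, the space of coefficient vectors indexed by C is C \<rightarrow>\<^sub>E UNIV, with the
   product topology and the Euclidean distance eucl_dist C. *)
definition coords :: "(real^'n) set \<Rightarrow> (real^'n) set \<Rightarrow> real^'n \<Rightarrow> (real^'n \<Rightarrow> real)" where
  "coords B C u = restrict (representation B u) C"

definition eucl_dist :: "'b set \<Rightarrow> ('b \<Rightarrow> real) \<Rightarrow> ('b \<Rightarrow> real) \<Rightarrow> real" where
  "eucl_dist C x y = L2_set (\<lambda>b. x b - y b) C"

definition basis_norm :: "(real^'n) set \<Rightarrow> real^'n \<Rightarrow> real" where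
  "basis_norm B u = Max ((\<lambda>b. \<bar>representation B u b\<bar>) ` B)"

definition D_M :: "real^'n^'n \<Rightarrow> (real^'n) set \<Rightarrow> real^'n \<Rightarrow> real^'n \<Rightarrow> real" where
  "D_M A B p q =
     (if p = q then 0
      else exp (LEAST t. basis_norm B (mat_exp ((- t) *\<^sub>R A) *v (p - q)) \<le> 1))"

definition bilip :: "('a \<Rightarrow> 'a \<Rightarrow> real) \<Rightarrow> ('b \<Rightarrow> 'b \<Rightarrow> real) \<Rightarrow> 'a set \<Rightarrow> ('a \<Rightarrow> 'b) \<Rightarrow> real \<Rightarrow> bool" where
  "bilip d d' X g K \<longleftrightarrow> 0 < K \<and>
     (\<forall>p\<in>X. \<forall>q\<in>X. (1 / K) * d p q \<le> d' (g p) (g q) \<and> d' (g p) (g q) \<le> K * d p q)"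

end

theory Submission
  imports Defs "HOL-Computational_Algebra.Fundamental_Theorem_Algebra"
begin

text \<open>Write \<open>E s = e\<^sup>s\<^sup>A\<close>. Cutting segments into pieces of unit size at scale \<open>t\<close> shows that a map \<open>F\<close>
  that is Lipschitz for \<open>D_M\<close> satisfies \<open>\<parallel>E (-t) (F p - F q)\<parallel> \<le> C (1 + \<parallel>E (-t) (p - q)\<parallel>)\<close> for all \<open>t\<close>,
  with \<open>C\<close> independent of \<open>t\<close>. For \<open>s = -t\<close> tending to infinity, \<open>E s v\<close> grows like
  \<open>e\<^sup>\<alpha>\<^sup>s s\<^sup>l\<^sup>-\<^sup>1 (A - \<alpha>)\<^sup>l\<^sup>-\<^sup>1 v' / (l-1)!\<close>, where \<open>(\<alpha>, l)\<close> is the largest pair whose block component \<open>v'\<close> of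
  \<open>v\<close> is nonzero, and \<open>(A - \<alpha>)\<^sup>l\<^sup>-\<^sup>1\<close> maps the block injectively into the Jordan basis. Comparing the growth
  of both sides, \<open>F p - F q\<close> has no component beyond the top block of \<open>p - q\<close>, and its component there is
  bounded by that of \<open>p - q\<close>. The lower bound is the same statement for the inverse: \<open>F\<close> is continuous,
  injective and proper, hence surjective by invariance of domain.\<close>

section \<open>Generalized eigenspaces\<close>

text \<open>The scale \<open>t\<close> may be any real number, and letting it tend to minus infinity
  is what makes the estimate sharp: the pieces of the segment become arbitrarily short, and after
  division by the growth rate of any block the additive 1 disappears, because all eigenvalues are
  positive. What remains is an inequality between leading coefficients. These still contain every
  coordinate of the block, since vectors of one level are sent to ends of distinct chains. Cutting a
  segment requires a convex domain. The bound for the inverse therefore cannot be run on the range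
  of F alone, and this is why surjectivity has to be established. The exponential is not estimated
  through a matrix norm: its series is summed in closed form on generalized eigenvectors. That these
  span the real space is obtained over the complex numbers, where polynomials split, and carried
  back by real and imaginary parts.\<close>

lemma mat_pow_Suc_mult: "mat_pow M (Suc k) *v v = M *v (mat_pow M k *v v)"
  by (simp add: matrix_vector_mul_assoc)

lemma mat_pow_add_mult: "mat_pow M (j + k) *v v = mat_pow M j *v (mat_pow M k *v v)"
  by (induction j) (simp_all add: matrix_vector_mul_assoc [symmetric])

lemma mat_pow_commute_mult: "mat_pow M j *v (mat_pow M k *v v) = mat_pow M k *v (mat_pow M j *v v)"
  by (metis add.commute mat_pow_add_mult)

lemma mat_pow_mult_eq_0_mono:
  assumes "mat_pow M j *v v = 0" "j \<le> k"
  shows "mat_pow M k *v v = 0"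
  by (metis assms le_Suc_ex mat_pow_add_mult mat_pow_commute_mult matrix_vector_mult_0_right)

lemma diff_mat_mult:
  fixes A :: "'a::field^'n^'n"
  shows "(A - mat \<mu>) *v v = A *v v - \<mu> *s v"
proof -
  have "mat \<mu> *v v = \<mu> *s v"
    by (simp add: vec_eq_iff matrix_vector_mult_def mat_def if_distrib [of "\<lambda>x. x * _"] cong: if_cong)
  then show ?thesis
    by (simp add: matrix_vector_mult_diff_rdistrib)
qed

lemma commute_diff_mat_mult:
  fixes A :: "'a::field^'n^'n"
  shows "(A - mat \<mu>) *v (A *v v) = A *v ((A - mat \<mu>) *v v)"
  by (simp add: diff_mat_mult matrix_vector_mult_diff_distrib vector_scalar_commute)

lemma commute_diff_mat_pow_mult:
  fixes A :: "'a::field^'n^'n"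
  shows "mat_pow (A - mat \<mu>) k *v (A *v v) = A *v (mat_pow (A - mat \<mu>) k *v v)"
proof (induction k)
  case (Suc k)
  then show ?case
    by (metis commute_diff_mat_mult mat_pow_Suc_mult)
qed simp

definition gen_eig :: "'a::field^'n^'n \<Rightarrow> 'a \<Rightarrow> ('a^'n) set" where
  "gen_eig A \<mu> = {v. \<exists>k. mat_pow (A - mat \<mu>) k *v v = 0}"

lemma gen_eigenspace_eq_gen_eig: "gen_eigenspace A \<alpha> = gen_eig A \<alpha>"
  by (auto simp: gen_eigenspace_def gen_eig_def ker_pow_def)

lemma gen_eig_subspace: "vec.subspace (gen_eig A \<mu>)"
proof (rule vec.subspaceI)
  show "0 \<in> gen_eig A \<mu>"
    by (auto simp: gen_eig_def)
next
  fix x y assume "x \<in> gen_eig A \<mu>" "y \<in> gen_eig A \<mu>"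
  then obtain j k where "mat_pow (A - mat \<mu>) j *v x = 0" "mat_pow (A - mat \<mu>) k *v y = 0"
    by (auto simp: gen_eig_def)
  then have "mat_pow (A - mat \<mu>) (j + k) *v (x + y) = 0"
    by (metis add.right_neutral le_add1 le_add2 mat_pow_mult_eq_0_mono matrix_vector_right_distrib)
  then show "x + y \<in> gen_eig A \<mu>"
    by (auto simp: gen_eig_def)
next
  fix c x assume "x \<in> gen_eig A \<mu>"
  then show "c *s x \<in> gen_eig A \<mu>"
    by (auto simp: gen_eig_def vector_scalar_commute)
qed

lemma gen_eig_mult:
  assumes "v \<in> gen_eig A \<mu>"
  shows "A *v v \<in> gen_eig A \<mu>"
  using assms by (auto simp: gen_eig_def commute_diff_mat_pow_mult) (metis matrix_vector_mult_0_right)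

lemma gen_eig_diff_mult:
  assumes "v \<in> gen_eig A \<mu>"
  shows "(A - mat \<beta>) *v v \<in> gen_eig A \<mu>"
  unfolding diff_mat_mult
  by (intro vec.subspace_diff vec.subspace_scale gen_eig_subspace gen_eig_mult assms)

lemma gen_eig_mat_pow_mult:
  assumes "v \<in> gen_eig A \<mu>"
  shows "mat_pow (A - mat \<beta>) k *v v \<in> gen_eig A \<mu>"
proof (induction k)
  case (Suc k)
  then show ?case
    by (metis mat_pow_Suc_mult gen_eig_diff_mult)
qed (simp add: assms)

lemma gen_eig_preimage:
  assumes "(A - mat \<mu>) *v v \<in> gen_eig A \<mu>"
  shows "v \<in> gen_eig A \<mu>"
proof -
  obtain k where "mat_pow (A - mat \<mu>) k *v ((A - mat \<mu>) *v v) = 0"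
    using assms by (auto simp: gen_eig_def)
  then have "mat_pow (A - mat \<mu>) (k + 1) *v v = 0"
    by (subst mat_pow_add_mult) simp
  then show ?thesis
    unfolding gen_eig_def by blast
qed

text \<open>On \<open>gen_eig A \<beta>\<close> the map A - \<alpha> is a nonzero scalar plus the
  nilpotent map A - \<beta>, hence invertible. The induction on the order of nilpotency unfolds the
  finite geometric series of the inverse.\<close>

lemma gen_eig_shift_surj:
  assumes "\<beta> \<noteq> \<alpha>" "w \<in> gen_eig A \<beta>"
  shows "\<exists>z\<in>gen_eig A \<beta>. (A - mat \<alpha>) *v z = w"
proof -
  obtain k where "mat_pow (A - mat \<beta>) k *v w = 0"
    using assms by (auto simp: gen_eig_def)
  then show ?thesis
    using assms(2)
  proof (induction k arbitrary: w)
    case 0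
    then show ?case
      by (intro bexI [of _ 0]) (auto simp: vec.subspace_0 gen_eig_subspace)
  next
    case (Suc k)
    have "mat_pow (A - mat \<beta>) k *v ((A - mat \<beta>) *v w) = 0"
      using Suc.prems(1) mat_pow_add_mult [of "A - mat \<beta>" k 1 w] by simp
    then obtain z where z: "z \<in> gen_eig A \<beta>" "(A - mat \<alpha>) *v z = (A - mat \<beta>) *v w"
      using Suc.IH [OF _ gen_eig_diff_mult [OF Suc.prems(2)]] by blast
    \<comment> \<open>This comes from A - \<alpha> = (A - \<beta>) + (\<beta> - \<alpha>):
      subtracting \<open>z\<close> cancels the nilpotent part of the image of \<open>w\<close>, and
      the scalar is divided out.\<close>
    let ?z = "(1 / (\<beta> - \<alpha>)) *s (w - z)"
    have "(A - mat \<alpha>) *v (w - z) = (\<beta> - \<alpha>) *s w"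
      by (simp add: matrix_vector_mult_diff_distrib z(2)) (simp add: diff_mat_mult vec.scale_left_diff_distrib)
    then have "(A - mat \<alpha>) *v ?z = w"
      using assms(1) by (simp only: vector_scalar_commute vec.scale_scale) simp
    moreover have "?z \<in> gen_eig A \<beta>"
      by (intro vec.subspace_scale vec.subspace_diff gen_eig_subspace Suc.prems z)
    ultimately show ?case
      by blast
  qed
qed

text \<open>A vector killed by A - \<alpha> is one on which every power of A - \<beta> acts as a
  nonzero scalar, so such a power can kill it only if it is zero.\<close>

lemma gen_eig_shift_inj:
  assumes "w \<in> gen_eig A \<beta>" "(A - mat \<alpha>) *v w = 0" "\<beta> \<noteq> \<alpha>"
  shows "w = 0"
proof -
  have *: "(A - mat \<beta>) *v w = (\<alpha> - \<beta>) *s w"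
    using assms(2) by (simp add: diff_mat_mult vec.scale_left_diff_distrib)
  have "mat_pow (A - mat \<beta>) k *v w = (\<alpha> - \<beta>) ^ k *s w" for k
  proof (induction k)
    case (Suc k)
    then show ?case
      by (simp only: mat_pow_Suc_mult vector_scalar_commute * vec.scale_scale power_Suc2)
  qed simp
  with assms show ?thesis
    by (auto simp: gen_eig_def)
qed

lemma gen_eig_shift_pow_inj:
  assumes "w \<in> gen_eig A \<beta>" "mat_pow (A - mat \<alpha>) k *v w = 0" "\<beta> \<noteq> \<alpha>"
  shows "w = 0"
  using assms(2)
proof (induction k)
  case (Suc k)
  then show ?case
    by (metis assms(1,3) gen_eig_mat_pow_mult gen_eig_shift_inj mat_pow_Suc_mult)
qed simp

text \<open>A suitable power of A - \<beta> removes the summand at \<beta> and keeps the others in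
  their own spaces. By induction their images vanish, and injectivity of the shifted powers there
  gives back the summands.\<close>

lemma gen_eig_sum_eq_0:
  assumes "finite M" "\<And>\<alpha>. \<alpha> \<in> M \<Longrightarrow> w \<alpha> \<in> gen_eig A \<alpha>" "(\<Sum>\<alpha>\<in>M. w \<alpha>) = 0" "\<alpha> \<in> M"
  shows "w \<alpha> = 0"
  using assms
proof (induction M arbitrary: w \<alpha> rule: finite_induct)
  case (insert \<beta> M)
  obtain k where k: "mat_pow (A - mat \<beta>) k *v w \<beta> = 0"
    using insert.prems(1) [of \<beta>] by (auto simp: gen_eig_def)
  have "0 = mat_pow (A - mat \<beta>) k *v (\<Sum>\<alpha>\<in>insert \<beta> M. w \<alpha>)"
    by (simp only: insert.prems matrix_vector_mult_0_right)
  also have "\<dots> = (\<Sum>\<alpha>\<in>M. mat_pow (A - mat \<beta>) k *v w \<alpha>)"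
    using insert.hyps k by (simp add: matrix_vector_right_distrib vec.linear_sum [OF matrix_vector_mul_linear_gen])
  finally have "mat_pow (A - mat \<beta>) k *v w \<gamma> = 0" if "\<gamma> \<in> M" for \<gamma>
    using insert.IH [of "\<lambda>\<alpha>. mat_pow (A - mat \<beta>) k *v w \<alpha>" \<gamma>] insert.prems(1) that
    by (simp add: gen_eig_mat_pow_mult)
  then have *: "w \<gamma> = 0" if "\<gamma> \<in> M" for \<gamma>
    using gen_eig_shift_pow_inj insert that by (metis insertCI)
  then have "w \<beta> = 0"
    using insert.prems(2) insert.hyps by simp
  with * show ?case
    using insert.prems by auto
qed simp

text \<open>Modulo \<open>gen_eig A \<alpha>\<close>, every vector of the span is the image under A
  - \<alpha> of a vector of the span, because A - \<alpha> is onto on the other generalized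
  eigenspaces. Subtracting such a preimage from \<open>x\<close> leaves a vector that A - \<alpha>
  sends into \<open>gen_eig A \<alpha>\<close>, hence an element of that space.\<close>

lemma span_gen_eig_preimage:
  fixes A :: "'a::field^'n^'n"
  assumes "(A - mat \<alpha>) *v x \<in> vec.span (\<Union>\<mu>. gen_eig A \<mu>)"
  shows "x \<in> vec.span (\<Union>\<mu>. gen_eig A \<mu>)"
proof -
  let ?T = "vec.span (\<Union>\<mu>. gen_eig A \<mu>)"
  let ?P = "\<lambda>y. \<exists>z\<in>?T. y - (A - mat \<alpha>) *v z \<in> gen_eig A \<alpha>"
  have "?P ((A - mat \<alpha>) *v x)"
    using assms
  proof (rule vec.span_induct)
    show "vec.subspace {y. ?P y}"
    proof (rule vec.subspaceI; clarsimp)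
      show "\<exists>z\<in>?T. - ((A - mat \<alpha>) *v z) \<in> gen_eig A \<alpha>"
        by (intro bexI [of _ 0]) (simp_all add: vec.span_zero vec.subspace_0 gen_eig_subspace)
    next
      fix y y' z z'
      assume *: "z \<in> ?T" "y - (A - mat \<alpha>) *v z \<in> gen_eig A \<alpha>" "z' \<in> ?T" "y' - (A - mat \<alpha>) *v z' \<in> gen_eig A \<alpha>"
      have "y + y' - (A - mat \<alpha>) *v (z + z') = (y - (A - mat \<alpha>) *v z) + (y' - (A - mat \<alpha>) *v z')"
        by (simp add: matrix_vector_right_distrib)
      then have "y + y' - (A - mat \<alpha>) *v (z + z') \<in> gen_eig A \<alpha>"
        using vec.subspace_add [OF gen_eig_subspace *(2,4)] by metis
      then show "\<exists>z\<in>?T. y + y' - (A - mat \<alpha>) *v z \<in> gen_eig A \<alpha>"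
        using * vec.span_add by blast
    next
      fix c y z
      assume *: "z \<in> ?T" "y - (A - mat \<alpha>) *v z \<in> gen_eig A \<alpha>"
      have "c *s y - (A - mat \<alpha>) *v (c *s z) = c *s (y - (A - mat \<alpha>) *v z)"
        by (simp add: vector_scalar_commute vec.scale_right_diff_distrib)
      then have "c *s y - (A - mat \<alpha>) *v (c *s z) \<in> gen_eig A \<alpha>"
        using vec.subspace_scale [OF gen_eig_subspace *(2)] by metis
      then show "\<exists>z\<in>?T. c *s y - (A - mat \<alpha>) *v z \<in> gen_eig A \<alpha>"
        using * vec.span_scale by blast
    qed
  next
    fix y assume "y \<in> (\<Union>\<mu>. gen_eig A \<mu>)"
    then obtain \<beta> where \<beta>: "y \<in> gen_eig A \<beta>"
      by blast
    show "?P y"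
    proof (cases "\<beta> = \<alpha>")
      case True
      with \<beta> show ?thesis
        by (auto intro!: bexI [of _ 0] simp: vec.span_zero)
    next
      case False
      then obtain z where "z \<in> gen_eig A \<beta>" "(A - mat \<alpha>) *v z = y"
        using gen_eig_shift_surj \<beta> by blast
      moreover from this(1) have "z \<in> ?T"
        by (meson UN_I UNIV_I vec.span_base)
      ultimately show ?thesis
        by (auto intro!: bexI [of _ z] simp: vec.subspace_0 gen_eig_subspace)
    qed
  qed
  then obtain z where z: "z \<in> ?T" "(A - mat \<alpha>) *v (x - z) \<in> gen_eig A \<alpha>"
    by (auto simp: matrix_vector_mult_diff_distrib)
  have "x - z \<in> ?T"
    by (meson UN_I UNIV_I vec.span_base gen_eig_preimage z(2))
  then show ?thesis
    using vec.span_add [OF _ z(1), of "x - z"] by simp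
qed

section \<open>Polynomials in a matrix applied to a vector\<close>

definition poly_mult_vec :: "'a::field poly \<Rightarrow> 'a^'n^'n \<Rightarrow> 'a^'n \<Rightarrow> 'a^'n" where
  "poly_mult_vec p A x = (\<Sum>i\<le>degree p. coeff p i *s (mat_pow A i *v x))"

lemma poly_mult_vec_altdef:
  assumes "degree p \<le> n"
  shows "poly_mult_vec p A x = (\<Sum>i\<le>n. coeff p i *s (mat_pow A i *v x))"
  unfolding poly_mult_vec_def using assms
  by (intro sum.mono_neutral_left) (auto simp: coeff_eq_0)

lemma poly_mult_vec_linear_factor:
  "poly_mult_vec ([:- \<mu>, 1:] * q) A x = (A - mat \<mu>) *v poly_mult_vec q A x"
proof -
  let ?n = "degree q"
  have deg: "degree ([:- \<mu>, 1:] * q) \<le> Suc ?n"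
    by (rule order_trans [OF degree_mult_le]) simp
  have "poly_mult_vec ([:- \<mu>, 1:] * q) A x
      = (\<Sum>i\<le>Suc ?n. coeff (pCons 0 q) i *s (mat_pow A i *v x) - \<mu> *s (coeff q i *s (mat_pow A i *v x)))"
    unfolding poly_mult_vec_altdef [OF deg]
    by (intro sum.cong) (simp_all add: vec.scale_left_diff_distrib)
  also have "\<dots> = (\<Sum>i\<le>Suc ?n. coeff (pCons 0 q) i *s (mat_pow A i *v x)) - \<mu> *s poly_mult_vec q A x"
    unfolding poly_mult_vec_altdef [of q "Suc ?n", OF le_SucI [OF order_refl]]
    by (simp only: sum_subtractf vec.scale_sum_right)
  also have "(\<Sum>i\<le>Suc ?n. coeff (pCons 0 q) i *s (mat_pow A i *v x)) = A *v poly_mult_vec q A x"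
    unfolding poly_mult_vec_def
    by (subst sum.atMost_Suc_shift)
      (simp add: vec.linear_sum [OF matrix_vector_mul_linear_gen] matrix_vector_mul_assoc [symmetric] vector_scalar_commute)
  finally show ?thesis
    by (simp add: diff_mat_mult)
qed

text \<open>The iterates of \<open>x\<close> cannot stay independent beyond the dimension, and the
  dependence of one of them on its predecessors is a monic polynomial annihilating this particular
  vector.\<close>

lemma exists_annihilating_poly:
  fixes A :: "'a::field^'n^'n"
  shows "\<exists>p. p \<noteq> 0 \<and> poly_mult_vec p A x = 0"
proof -
  define w where "w i = mat_pow A i *v x" for i
  have "\<exists>k. w k \<in> vec.span (w ` {..<k})"
  proof (rule ccontr)
    assume *: "\<not> ?thesis"
    have "vec.independent (w ` {..<k}) \<and> card (w ` {..<k}) = k" for k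
    proof (induction k)
      case (Suc k)
      have k: "w k \<notin> vec.span (w ` {..<k})"
        using * by simp
      then have "w k \<notin> w ` {..<k}"
        by (rule contrapos_nn) (rule vec.span_base)
      moreover have "vec.independent (insert (w k) (w ` {..<k}))"
        by (rule vec.independent_insertI) (use k Suc in auto)
      ultimately show ?case
        using Suc by (simp add: lessThan_Suc)
    qed (simp add: vec.independent_empty)
    then have "Suc (CARD('n)) \<le> vec.dim (UNIV :: ('a^'n) set)"
      by (metis vec.independent_card_le_dim subset_UNIV)
    then show False
      unfolding vec_dim_card by simp
  qed
  then obtain k where "w k \<in> vec.span (w ` {..<k})"
    by blast
  \<comment> \<open>Coefficients are wanted per exponent, whereas a span offers them per vector; the
    sums indexed by exponents are shown to form a subspace containing the generators.\<close>
  then have "\<exists>c. w k = (\<Sum>i<k. c i *s w i)"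
  proof -
    assume "w k \<in> vec.span (w ` {..<k})"
    then show ?thesis
    proof (rule vec.span_induct)
      show "vec.subspace {y. \<exists>c. y = (\<Sum>i<k. c i *s w i)}" (is "vec.subspace ?U")
      proof (rule vec.subspaceI)
        show "0 \<in> ?U"
          by (intro CollectI exI [of _ "\<lambda>_. 0"]) simp
      next
        fix y z assume "y \<in> ?U" "z \<in> ?U"
        then obtain c d where "y = (\<Sum>i<k. c i *s w i)" "z = (\<Sum>i<k. d i *s w i)"
          by blast
        then show "y + z \<in> ?U"
          by (intro CollectI exI [of _ "\<lambda>i. c i + d i"]) (simp add: vec.scale_left_distrib sum.distrib)
      next
        fix a y assume "y \<in> ?U"
        then obtain c where "y = (\<Sum>i<k. c i *s w i)"
          by blast
        then show "a *s y \<in> ?U"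
          by (intro CollectI exI [of _ "\<lambda>i. a * c i"]) (simp add: vec.scale_sum_right)
      qed
    next
      fix y assume "y \<in> w ` {..<k}"
      then obtain j where "j < k" "y = w j"
        by blast
      then have "y = (\<Sum>i<k. (if i = j then 1 else 0) *s w i)"
        by (simp add: if_distrib [of "\<lambda>c. c *s _"] cong: if_cong)
      then show "\<exists>c. y = (\<Sum>i<k. c i *s w i)"
        by (rule exI [of _ "\<lambda>i. if i = j then 1 else 0"])
    qed
  qed
  then obtain c where c: "w k = (\<Sum>i<k. c i *s w i)"
    by (elim exE)
  define p where "p = monom 1 k - (\<Sum>i<k. monom (c i) i)"
  have coeff: "coeff p i = (if i = k then 1 else if i < k then - c i else 0)" for i
    by (simp add: p_def coeff_sum sum.delta')
  then have "degree p \<le> k"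
    by (intro degree_le) auto
  then have "poly_mult_vec p A x = (\<Sum>i<k. (- c i) *s w i) + w k"
    by (simp add: poly_mult_vec_altdef coeff lessThan_Suc_atMost [symmetric] flip: w_def)
  then have "poly_mult_vec p A x = 0"
    by (simp add: c sum_negf)
  moreover have "p \<noteq> 0"
    using coeff [of k] by auto
  ultimately show ?thesis
    by blast
qed

text \<open>An annihilating polynomial splits over the complex numbers, and each linear factor can
  be undone without leaving the span by \<open>span_gen_eig_preimage\<close>.\<close>

lemma span_gen_eig_complex:
  fixes A :: "complex^'n^'n"
  shows "x \<in> vec.span (\<Union>\<mu>. gen_eig A \<mu>)"
proof -
  let ?T = "vec.span (\<Union>\<mu>. gen_eig A \<mu>)"
  \<comment> \<open>Membership in the span, rather than p(A) x = 0, is the property that survives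
    the removal of a factor.\<close>
  have *: "x \<in> ?T" if "p \<noteq> 0" "poly_mult_vec p A x \<in> ?T" for p x
    using that
  proof (induction "degree p" arbitrary: p x)
    case 0
    then obtain c where "p = [:c:]" "c \<noteq> 0"
      by (metis degree_eq_zeroE pCons_0_0)
    with 0 have "c *s x \<in> ?T"
      by (simp add: poly_mult_vec_def)
    then have "(1 / c) *s (c *s x) \<in> ?T"
      by (rule vec.span_scale)
    with \<open>c \<noteq> 0\<close> show ?case
      by simp
  next
    case (Suc n)
    obtain \<mu> where "poly p \<mu> = 0"
      using fundamental_theorem_of_algebra_alt [of p] Suc.hyps(2) by fastforce
    then obtain q where q: "p = [:- \<mu>, 1:] * q"
      by (auto simp: poly_eq_0_iff_dvd)
    with Suc.prems have "q \<noteq> 0"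
      by auto
    then have "degree p = Suc (degree q)"
      unfolding q by (subst degree_mult_eq) auto
    then have "n = degree q"
      using Suc.hyps by simp
    moreover have "poly_mult_vec q A x \<in> ?T"
      using Suc.prems span_gen_eig_preimage unfolding q poly_mult_vec_linear_factor by blast
    ultimately show ?case
      using Suc.hyps(1) \<open>q \<noteq> 0\<close> by blast
  qed
  obtain p where "p \<noteq> 0" "poly_mult_vec p A x = 0"
    using exists_annihilating_poly by blast
  with * [of p x] show ?thesis
    by (simp add: vec.span_zero)
qed

section \<open>Real spectrum and the exponential series\<close>

text \<open>The last nonzero vector among the iterates of \<open>w\<close> under A - \<mu> is an
  eigenvector.\<close>

lemma eigenvalue_if_gen_eig_nonzero:
  assumes "w \<in> gen_eig A \<mu>" "w \<noteq> 0"
  shows "eigenvalue A \<mu>"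
proof -
  let ?P = "\<lambda>k. mat_pow (A - mat \<mu>) k *v w = 0"
  obtain k where k: "?P k"
    using assms by (auto simp: gen_eig_def)
  define m where "m = (LEAST k. ?P k)"
  have "?P m"
    unfolding m_def using k by (rule LeastI)
  then obtain j where j: "m = Suc j"
    using assms(2) by (cases m) auto
  define y where "y = mat_pow (A - mat \<mu>) j *v w"
  have "y \<noteq> 0"
    using not_less_Least [of j ?P] j by (simp add: m_def y_def)
  moreover have "A *v y - \<mu> *s y = 0"
    using \<open>?P m\<close> unfolding j mat_pow_Suc_mult y_def [symmetric] diff_mat_mult .
  ultimately show ?thesis
    by (auto simp: eigenvalue_def)
qed

section \<open>Descent from complex to real vectors\<close>

definition cvec :: "real^'n \<Rightarrow> complex^'n" where
  "cvec v = (\<chi> i. complex_of_real (v $ i))"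

definition Re_vec :: "complex^'n \<Rightarrow> real^'n" where
  "Re_vec x = (\<chi> i. Re (x $ i))"

definition Im_vec :: "complex^'n \<Rightarrow> real^'n" where
  "Im_vec x = (\<chi> i. Im (x $ i))"

lemma Re_vec_complexify: "Re_vec (complexify A *v x) = A *v Re_vec x"
  by (simp add: vec_eq_iff Re_vec_def complexify_def matrix_vector_mult_def)

lemma Im_vec_complexify: "Im_vec (complexify A *v x) = A *v Im_vec x"
  by (simp add: vec_eq_iff Im_vec_def complexify_def matrix_vector_mult_def)

lemma complexify_cvec: "complexify A *v cvec v = cvec (A *v v)"
  by (simp add: vec_eq_iff cvec_def complexify_def matrix_vector_mult_def)

lemma complexify_diff_mat: "complexify A - mat (complex_of_real r) = complexify (A - mat r)"
  by (simp add: vec_eq_iff complexify_def mat_def)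

lemma Re_vec_complexify_pow: "Re_vec (mat_pow (complexify A) k *v x) = mat_pow A k *v Re_vec x"
  by (induction k) (simp_all add: matrix_vector_mul_assoc [symmetric] Re_vec_complexify)

lemma Im_vec_complexify_pow: "Im_vec (mat_pow (complexify A) k *v x) = mat_pow A k *v Im_vec x"
  by (induction k) (simp_all add: matrix_vector_mul_assoc [symmetric] Im_vec_complexify)

lemma Re_Im_vec_gen_eig:
  assumes "x \<in> gen_eig (complexify A) (complex_of_real r)"
  shows "Re_vec x \<in> gen_eig A r" "Im_vec x \<in> gen_eig A r"
proof -
  obtain k where k: "mat_pow (complexify (A - mat r)) k *v x = 0"
    using assms by (auto simp: gen_eig_def complexify_diff_mat)
  show "Re_vec x \<in> gen_eig A r"
    using arg_cong [OF k, of Re_vec] by (auto simp: gen_eig_def Re_vec_complexify_pow) (auto simp: Re_vec_def vec_eq_iff)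
  show "Im_vec x \<in> gen_eig A r"
    using arg_cong [OF k, of Im_vec] by (auto simp: gen_eig_def Im_vec_complexify_pow) (auto simp: Im_vec_def vec_eq_iff)
qed

lemma eigenvalue_complexify:
  assumes "eigenvalue A \<alpha>"
  shows "eigenvalue (complexify A) (complex_of_real \<alpha>)"
proof -
  obtain v where v: "v \<noteq> 0" "A *v v = \<alpha> *s v"
    using assms by (auto simp: eigenvalue_def)
  have "cvec v \<noteq> 0"
    using v(1) by (auto simp: cvec_def vec_eq_iff)
  moreover have "complexify A *v cvec v = complex_of_real \<alpha> *s cvec v"
    by (simp add: complexify_cvec v(2)) (simp add: cvec_def vec_eq_iff)
  ultimately show ?thesis
    by (auto simp: eigenvalue_def)
qed

lemma span_gen_eig_real:
  fixes A :: "real^'n^'n"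
  assumes real: "\<And>\<mu>. eigenvalue (complexify A) \<mu> \<Longrightarrow> \<mu> \<in> \<real>"
  shows "u \<in> span (\<Union>\<alpha>\<in>Collect (eigenvalue A). gen_eig A \<alpha>)"
proof -
  let ?W = "span (\<Union>\<alpha>\<in>Collect (eigenvalue A). gen_eig A \<alpha>)"
  have W: "w \<in> ?W" if "w \<in> gen_eig A \<alpha>" for w \<alpha>
  proof (cases "w = 0")
    case False
    with that have "eigenvalue A \<alpha>"
      by (rule eigenvalue_if_gen_eig_nonzero)
    with that show ?thesis
      by (intro span_base) auto
  qed (simp add: span_zero)
  \<comment> \<open>Complex scalars mix real and imaginary parts, so the induction over the complex
    span has to carry both.\<close>
  have "Re_vec x \<in> ?W \<and> Im_vec x \<in> ?W" for x
    using span_gen_eig_complex [of x "complexify A"]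
  proof (rule vec.span_induct)
    show "vec.subspace {x. Re_vec x \<in> ?W \<and> Im_vec x \<in> ?W}"
    proof (rule vec.subspaceI)
      have "Re_vec (0 :: complex^'n) = 0" "Im_vec (0 :: complex^'n) = 0"
        by (simp_all add: Re_vec_def Im_vec_def vec_eq_iff)
      then show "0 \<in> {x. Re_vec x \<in> ?W \<and> Im_vec x \<in> ?W}"
        by (simp add: span_zero)
    next
      fix x y assume "x \<in> {x. Re_vec x \<in> ?W \<and> Im_vec x \<in> ?W}" "y \<in> {x. Re_vec x \<in> ?W \<and> Im_vec x \<in> ?W}"
      moreover have "Re_vec (x + y) = Re_vec x + Re_vec y" "Im_vec (x + y) = Im_vec x + Im_vec y"
        by (simp_all add: Re_vec_def Im_vec_def vec_eq_iff)
      ultimately show "x + y \<in> {x. Re_vec x \<in> ?W \<and> Im_vec x \<in> ?W}"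
        by (simp add: span_add)
    next
      fix c x assume "x \<in> {x. Re_vec x \<in> ?W \<and> Im_vec x \<in> ?W}"
      moreover have "Re_vec (c *s x) = Re c *\<^sub>R Re_vec x - Im c *\<^sub>R Im_vec x"
         "Im_vec (c *s x) = Re c *\<^sub>R Im_vec x + Im c *\<^sub>R Re_vec x"
        by (simp_all add: Re_vec_def Im_vec_def vec_eq_iff)
      ultimately show "c *s x \<in> {x. Re_vec x \<in> ?W \<and> Im_vec x \<in> ?W}"
        by (simp add: span_add span_diff span_scale)
    qed
  next
    fix x assume "x \<in> (\<Union>\<mu>. gen_eig (complexify A) \<mu>)"
    then obtain \<mu> where \<mu>: "x \<in> gen_eig (complexify A) \<mu>"
      by blast
    show "Re_vec x \<in> ?W \<and> Im_vec x \<in> ?W"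
    proof (cases "x = 0")
      case True
      then show ?thesis
        by (simp add: Re_vec_def Im_vec_def span_zero flip: zero_vec_def)
    next
      case False
      with \<mu> have "\<mu> \<in> \<real>"
        using real eigenvalue_if_gen_eig_nonzero by blast
      then show ?thesis
        using \<mu> W Re_Im_vec_gen_eig by (metis Reals_cases)
    qed
  qed
  then have "Re_vec (cvec u) \<in> ?W"
    by blast
  moreover have "Re_vec (cvec u) = u"
    by (simp add: Re_vec_def cvec_def vec_eq_iff)
  ultimately show ?thesis
    by simp
qed

section \<open>The exponential series on generalized eigenvectors\<close>

lemma mat_pow_eq_sum_shift:
  fixes A :: "real^'n^'n"
  assumes "mat_pow (A - mat \<alpha>) m *v w = 0"
  shows "mat_pow A k *v w = (\<Sum>j<m. (of_nat (k choose j) * \<alpha> ^ (k - j)) *\<^sub>R (mat_pow (A - mat \<alpha>) j *v w))"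
proof (induction k)
  case 0
  show ?case
  proof (cases "m = 0")
    case True
    with assms show ?thesis by simp
  next
    case False
    then have "(\<Sum>j<m. (real (0 choose j) * \<alpha> ^ (0 - j)) *\<^sub>R (mat_pow (A - mat \<alpha>) j *v w))
       = (\<Sum>j\<in>{0}. (real (0 choose j) * \<alpha> ^ (0 - j)) *\<^sub>R (mat_pow (A - mat \<alpha>) j *v w))"
      by (intro sum.mono_neutral_right) auto
    then show ?thesis by simp
  qed
next
  case (Suc k)
  define N where "N j = mat_pow (A - mat \<alpha>) j *v w" for j
  \<comment> \<open>These are the coefficients of the binomial expansion of A = (A - \<alpha>) +
    \<alpha>. For j > k the exponent is truncated to 0, but the binomial coefficient
    vanishes.\<close>
  define c where "c k j = real (k choose j) * \<alpha> ^ (k - j)" for k j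
  have N: "A *v N j = N (Suc j) + \<alpha> *\<^sub>R N j" for j
  proof -
    have "N (Suc j) = (A - mat \<alpha>) *v N j"
      unfolding N_def mat_pow_Suc_mult ..
    then show ?thesis
      by (simp add: diff_mat_mult scalar_mult_eq_scaleR)
  qed
  have c0: "c (Suc k) 0 = \<alpha> * c k 0"
    by (simp add: c_def)
  \<comment> \<open>Pascal's rule; the case split is caused by the truncated subtraction in the
    exponents.\<close>
  have cS: "c (Suc k) (Suc j) = c k j + \<alpha> * c k (Suc j)" for j
  proof (cases "j < k")
    case True
    then have "k - j = Suc (k - Suc j)"
      by simp
    then show ?thesis
      by (simp add: c_def algebra_simps)
  next
    case False
    then show ?thesis
      by (cases "j = k") (simp_all add: c_def)
  qed
  have "N m = 0"
    using assms by (simp add: N_def)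
  have "mat_pow A (Suc k) *v w = A *v (\<Sum>j<m. c k j *\<^sub>R N j)"
    unfolding mat_pow_Suc_mult Suc.IH c_def N_def ..
  also have "\<dots> = (\<Sum>j<m. c k j *\<^sub>R N (Suc j)) + (\<Sum>j<m. (\<alpha> * c k j) *\<^sub>R N j)"
    by (simp add: linear_sum [OF matrix_vector_mul_linear] matrix_vector_mult_scaleR N
        scaleR_add_right sum.distrib mult.commute)
  \<comment> \<open>Since \<open>N m = 0\<close>, one more term may be added; this makes room for
    the shift of the index.\<close>
  also have "(\<Sum>j<m. (\<alpha> * c k j) *\<^sub>R N j) = (\<Sum>j<Suc m. (\<alpha> * c k j) *\<^sub>R N j)"
    by (simp add: \<open>N m = 0\<close>)
  also have "\<dots> = c (Suc k) 0 *\<^sub>R N 0 + (\<Sum>j<m. (\<alpha> * c k (Suc j)) *\<^sub>R N (Suc j))"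
    by (subst sum.lessThan_Suc_shift) (simp add: c0)
  also have "(\<Sum>j<m. c k j *\<^sub>R N (Suc j)) + \<dots> = c (Suc k) 0 *\<^sub>R N 0 + (\<Sum>j<m. c (Suc k) (Suc j) *\<^sub>R N (Suc j))"
    by (simp add: cS scaleR_add_left sum.distrib)
  also have "\<dots> = (\<Sum>j<Suc m. c (Suc k) j *\<^sub>R N j)"
    by (subst sum.lessThan_Suc_shift) simp
  also have "\<dots> = (\<Sum>j<m. c (Suc k) j *\<^sub>R N j)"
    by (simp add: \<open>N m = 0\<close>)
  finally show ?case
    unfolding c_def N_def .
qed

text \<open>Cancelling k! leaves s^j / j! times (\<alpha> s)^(k-j) / (k-j)!, the exponential series
  delayed by \<open>j\<close> places; the terms before that vanish with the binomial
  coefficient.\<close>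

lemma binomial_exp_sums:
  fixes s \<alpha> :: real
  shows "(\<lambda>k. s ^ k / fact k * (real (k choose j) * \<alpha> ^ (k - j))) sums (s ^ j / fact j * exp (\<alpha> * s))"
proof -
  let ?f = "\<lambda>k. s ^ k / fact k * (real (k choose j) * \<alpha> ^ (k - j))"
  have "(\<lambda>n. (\<alpha> * s) ^ n /\<^sub>R fact n) sums exp (\<alpha> * s)"
    by (rule exp_converges)
  then have "(\<lambda>n. s ^ j / fact j * ((\<alpha> * s) ^ n /\<^sub>R fact n)) sums (s ^ j / fact j * exp (\<alpha> * s))"
    by (rule sums_mult)
  moreover have "s ^ j / fact j * ((\<alpha> * s) ^ n /\<^sub>R fact n) = ?f (n + j)" for n
    by (simp add: binomial_fact power_add power_mult_distrib field_simps)
  ultimately have "(\<lambda>n. ?f (n + j)) sums (s ^ j / fact j * exp (\<alpha> * s))"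
    by simp
  then have "?f sums (s ^ j / fact j * exp (\<alpha> * s) + (\<Sum>i<j. ?f i))"
    by (rule sums_iff_shift [THEN iffD1])
  moreover have "(\<Sum>i<j. ?f i) = 0"
    by (intro sum.neutral) simp
  ultimately show ?thesis
    by (simp only: add_0_right)
qed

text \<open>The exponential of the nilpotent part s (A - \<alpha>): stopping after \<open>m\<close>
  terms is exact on vectors killed by the \<open>m\<close>-th power.\<close>

definition exp_partial :: "real^'n^'n \<Rightarrow> real \<Rightarrow> nat \<Rightarrow> real \<Rightarrow> real^'n \<Rightarrow> real^'n" where
  "exp_partial A \<alpha> m s w = (\<Sum>j<m. (s ^ j / fact j) *\<^sub>R (mat_pow (A - mat \<alpha>) j *v w))"

lemma exp_series_sums_gen_eig:
  fixes A :: "real^'n^'n"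
  assumes "mat_pow (A - mat \<alpha>) m *v w = 0"
  shows "(\<lambda>k. (s ^ k / fact k) *\<^sub>R (mat_pow A k *v w)) sums (exp (\<alpha> * s) *\<^sub>R exp_partial A \<alpha> m s w)"
proof -
  have "(\<lambda>k. \<Sum>j<m. (s ^ k / fact k * (real (k choose j) * \<alpha> ^ (k - j))) *\<^sub>R (mat_pow (A - mat \<alpha>) j *v w))
     sums (\<Sum>j<m. (s ^ j / fact j * exp (\<alpha> * s)) *\<^sub>R (mat_pow (A - mat \<alpha>) j *v w))"
    by (intro sums_sum bounded_linear.sums [OF bounded_linear_scaleR_left] binomial_exp_sums)
  then show ?thesis
    by (simp add: mat_pow_eq_sum_shift [OF assms] exp_partial_def scaleR_sum_right mult.commute)
qed

text \<open>The functional equation of the exponential as a Cauchy product. Terms with i + j at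
  least \<open>m\<close> vanish, so the square of indices shrinks to the triangle on which the
  binomial theorem applies.\<close>

lemma exp_partial_add:
  fixes A :: "real^'n^'n"
  assumes "mat_pow (A - mat \<alpha>) m *v w = 0"
  shows "exp_partial A \<alpha> m s (exp_partial A \<alpha> m t w) = exp_partial A \<alpha> m (s + t) w"
proof -
  define N where "N j = mat_pow (A - mat \<alpha>) j *v w" for j
  have N0: "j < m" if "N j \<noteq> 0" for j
    using mat_pow_mult_eq_0_mono [OF assms, of j] that by (force simp: N_def not_less)
  define g where "g i j = ((s ^ i / fact i) * (t ^ j / fact j)) *\<^sub>R N (i + j)" for i j
  have "exp_partial A \<alpha> m s (exp_partial A \<alpha> m t w) = (\<Sum>i<m. \<Sum>j<m. g i j)"
    by (simp add: exp_partial_def g_def N_def linear_sum [OF matrix_vector_mul_linear]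
        matrix_vector_mult_scaleR scaleR_sum_right mat_pow_add_mult)
  also have "\<dots> = (\<Sum>(i,j)\<in>{..<m} \<times> {..<m}. g i j)"
    by (rule sum.cartesian_product)
  also have "\<dots> = (\<Sum>(i,j)\<in>{(i,j). i + j < m}. g i j)"
    by (rule sum.mono_neutral_right) (auto simp: g_def intro: N0)
  also have "\<dots> = (\<Sum>k<m. \<Sum>i\<le>k. g i (k - i))"
    by (rule sum.triangle_reindex)
  also have "\<dots> = (\<Sum>k<m. ((s + t) ^ k / fact k) *\<^sub>R N k)"
  proof (rule sum.cong)
    fix k
    have "(\<Sum>i\<le>k. g i (k - i)) = (\<Sum>i\<le>k. (s ^ i / fact i) * (t ^ (k - i) / fact (k - i))) *\<^sub>R N k"
      unfolding scaleR_sum_left g_def by (intro sum.cong) auto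
    also have "(\<Sum>i\<le>k. (s ^ i / fact i) * (t ^ (k - i) / fact (k - i))) = (s + t) ^ k / fact k"
      unfolding binomial_ring sum_divide_distrib by (intro sum.cong) (auto simp: binomial_fact field_simps)
    finally show "(\<Sum>i\<le>k. g i (k - i)) = ((s + t) ^ k / fact k) *\<^sub>R N k" .
  qed simp
  finally show ?thesis
    by (simp add: exp_partial_def N_def)
qed

lemma mat_pow_exp_partial:
  assumes "mat_pow (A - mat \<alpha>) m *v w = 0"
  shows "mat_pow (A - mat \<alpha>) m *v exp_partial A \<alpha> m s w = 0"
proof -
  have "mat_pow (A - mat \<alpha>) m *v (mat_pow (A - mat \<alpha>) j *v w) = 0" for j
    by (metis assms mat_pow_commute_mult matrix_vector_mult_0_right)
  then show ?thesis
    by (simp add: exp_partial_def linear_sum [OF matrix_vector_mul_linear] matrix_vector_mult_scaleR)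
qed

lemma scaleR_matrix_vector_mult:
  fixes M :: "real^'n^'m"
  shows "(c *\<^sub>R M) *v v = c *\<^sub>R (M *v v)"
  by (simp add: vec_eq_iff matrix_vector_mult_def sum_distrib_left mult.assoc)

lemma bounded_linear_matrix_vector_mult_left:
  fixes v :: "real^'n"
  shows "bounded_linear (\<lambda>M :: real^'n^'m. M *v v)"
  by (intro linear_conv_bounded_linear [THEN iffD1] linearI)
    (simp_all add: matrix_vector_mult_add_rdistrib scaleR_matrix_vector_mult)

lemma mat_pow_scaleR_mult:
  fixes A :: "real^'n^'n"
  shows "mat_pow (s *\<^sub>R A) k *v v = s ^ k *\<^sub>R (mat_pow A k *v v)"
proof (induction k)
  case (Suc k)
  then show ?case
    by (simp only: mat_pow_Suc_mult scaleR_matrix_vector_mult matrix_vector_mult_scaleR scaleR_scaleR power_Suc mult.commute)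
qed simp

text \<open>Convergence of the series behind \<open>mat_exp\<close> is proved vector by vector: it
  is explicit on generalized eigenvectors and passes to linear combinations. Applied to the unit
  vectors it yields convergence of every matrix entry, hence of the matrix series.\<close>

lemma mat_exp_mult_sums:
  fixes A :: "real^'n^'n"
  assumes span: "\<And>u. u \<in> span (\<Union>\<alpha>\<in>Collect (eigenvalue A). gen_eig A \<alpha>)"
  shows "(\<lambda>k. (s ^ k / fact k) *\<^sub>R (mat_pow A k *v v)) sums (mat_exp (s *\<^sub>R A) *v v)"
proof -
  have summable: "summable (\<lambda>k. (s ^ k / fact k) *\<^sub>R (mat_pow A k *v v))" for v
    using span [of v]
  proof (rule span_induct)
    show "subspace {v. summable (\<lambda>k. (s ^ k / fact k) *\<^sub>R (mat_pow A k *v v))}"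
    proof (rule subspaceI)
      fix c x assume "x \<in> {v. summable (\<lambda>k. (s ^ k / fact k) *\<^sub>R (mat_pow A k *v v))}"
      then have "summable (\<lambda>k. c *\<^sub>R ((s ^ k / fact k) *\<^sub>R (mat_pow A k *v x)))"
        by (intro summable_scaleR_right) simp
      then show "c *\<^sub>R x \<in> {v. summable (\<lambda>k. (s ^ k / fact k) *\<^sub>R (mat_pow A k *v v))}"
        by (simp only: mem_Collect_eq matrix_vector_mult_scaleR scaleR_scaleR mult.commute)
    qed (auto simp: matrix_vector_right_distrib scaleR_add_right intro: summable_add)
  next
    fix w assume "w \<in> (\<Union>\<alpha>\<in>Collect (eigenvalue A). gen_eig A \<alpha>)"
    then obtain \<alpha> m where "mat_pow (A - mat \<alpha>) m *v w = 0"
      by (auto simp: gen_eig_def)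
    then show "summable (\<lambda>k. (s ^ k / fact k) *\<^sub>R (mat_pow A k *v w))"
      by (rule sums_summable [OF exp_series_sums_gen_eig])
  qed
  define T where "T k = (1 / fact k) *\<^sub>R mat_pow (s *\<^sub>R A) k" for k
  have T: "T k *v v = (s ^ k / fact k) *\<^sub>R (mat_pow A k *v v)" for k v
    by (simp add: T_def scaleR_matrix_vector_mult mat_pow_scaleR_mult)
  have "T sums (\<chi> i j. \<Sum>k. T k $ i $ j)"
    unfolding sums_def
  proof (intro vec_tendstoI)
    fix i j
    have "summable (\<lambda>k. (T k *v axis j 1) $ i)"
      unfolding T by (rule bounded_linear.summable [OF bounded_linear_vec_nth summable])
    then have "summable (\<lambda>k. T k $ i $ j)"
      by (simp add: matrix_vector_mult_basis column_def)
    then have "(\<lambda>k. T k $ i $ j) sums (\<Sum>k. T k $ i $ j)"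
      by (rule summable_sums)
    then show "(\<lambda>n. (\<Sum>k<n. T k) $ i $ j) \<longlonglongrightarrow> (\<chi> i j. \<Sum>k. T k $ i $ j) $ i $ j"
      by (simp add: sums_def)
  qed
  then have "T sums mat_exp (s *\<^sub>R A)"
    unfolding mat_exp_def T_def by (simp add: sums_iff)
  then have "(\<lambda>k. T k *v v) sums (mat_exp (s *\<^sub>R A) *v v)"
    by (rule bounded_linear.sums [OF bounded_linear_matrix_vector_mult_left])
  then show ?thesis
    by (simp add: T)
qed

section \<open>Jordan bases and the flow\<close>

lemma mat_pow_eq_0_unique:
  assumes "mat_pow M l *v b = 0" "mat_pow M (l - 1) *v b \<noteq> 0" "1 \<le> l"
    and "mat_pow M k *v b = 0" "mat_pow M (k - 1) *v b \<noteq> 0" "1 \<le> k"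
  shows "l = k"
proof (rule ccontr)
  assume "l \<noteq> k"
  then consider "l \<le> k - 1" | "k \<le> l - 1"
    using assms(3,6) by linarith
  then show False
    using assms mat_pow_mult_eq_0_mono by cases blast+
qed

locale jordan_data =
  fixes A :: "real^'n^'n" and S :: "real \<Rightarrow> ((real^'n) \<times> nat) set"
  assumes spectrum: "eigenvalue (complexify A) \<mu> \<Longrightarrow> \<mu> \<in> \<real> \<and> 0 < Re \<mu>"
    and chains: "jordan_chains A S"
begin

abbreviation B :: "(real^'n) set" where "B \<equiv> jbasis A S"

abbreviation N :: "real \<Rightarrow> nat \<Rightarrow> real^'n \<Rightarrow> real^'n" where
  "N \<alpha> k v \<equiv> mat_pow (A - mat \<alpha>) k *v v"

lemma eigenvalue_pos: "eigenvalue A \<alpha> \<Longrightarrow> 0 < \<alpha>"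
  using spectrum eigenvalue_complexify by fastforce

lemma span_gen_eig: "u \<in> span (\<Union>\<alpha>\<in>Collect (eigenvalue A). gen_eig A \<alpha>)"
  using span_gen_eig_real spectrum by blast

text \<open>A vector \<open>k\<close> steps along a chain of length \<open>m\<close> has order
  exactly \<open>m - k\<close>, so its level counts its position from the end of the chain, and the
  last nonvanishing power sends it to that end.\<close>

lemma chainE:
  assumes "eigenvalue A \<alpha>" "b \<in> jbasis_at A S \<alpha>"
  obtains v m k where "(v, m) \<in> S \<alpha>" "k < m" "b = N \<alpha> k v" "N \<alpha> (m - k) b = 0" "N \<alpha> (m - k - 1) b \<noteq> 0"
    "N \<alpha> (m - k - 1) b = N \<alpha> (m - 1) v"
proof -
  obtain v m k where b: "(v, m) \<in> S \<alpha>" "k < m" "b = N \<alpha> k v"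
    using assms(2) by (auto simp: jbasis_at_def chain_def)
  with chains assms(1) have v: "N \<alpha> m v = 0" "N \<alpha> (m - 1) v \<noteq> 0"
    by (auto simp: jordan_chains_def)
  have "N \<alpha> (m - k) b = N \<alpha> m v"
    unfolding b(3) mat_pow_add_mult [symmetric] using b(2) by simp
  moreover have "N \<alpha> (m - k - 1) b = N \<alpha> (m - 1) v"
    unfolding b(3) mat_pow_add_mult [symmetric] using b(2) by simp
  ultimately show thesis
    using v by (intro that [OF b]) simp_all
qed

lemma jlevelD:
  assumes "b \<in> jlevel A S (\<alpha>, l)"
  shows "b \<in> jbasis_at A S \<alpha>" "N \<alpha> l b = 0" "N \<alpha> (l - 1) b \<noteq> 0"
  using assms by (auto simp: jlevel_def ker_pow_def)

lemma jpairsD: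
  assumes "(\<alpha>, l) \<in> jpairs A S"
  shows "eigenvalue A \<alpha>" "1 \<le> l"
  using assms by (auto simp: jpairs_def)

lemma jbasis_at_level:
  assumes "eigenvalue A \<alpha>" "b \<in> jbasis_at A S \<alpha>"
  shows "\<exists>l. (\<alpha>, l) \<in> jpairs A S \<and> b \<in> jlevel A S (\<alpha>, l)"
proof -
  obtain v m k where *: "(v, m) \<in> S \<alpha>" "k < m" "N \<alpha> (m - k) b = 0" "N \<alpha> (m - k - 1) b \<noteq> 0"
    using chainE [OF assms] by blast
  then have "b \<in> jlevel A S (\<alpha>, m - k)"
    using assms(2) by (auto simp: jlevel_def ker_pow_def)
  then show ?thesis
    using assms(1) *(2) by (intro exI [of _ "m - k"]) (auto simp: jpairs_def)
qed

lemma jbasis_eq: "B = (\<Union>\<alpha>\<in>Collect (eigenvalue A). jbasis_at A S \<alpha>)"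
proof
  show "B \<subseteq> (\<Union>\<alpha>\<in>Collect (eigenvalue A). jbasis_at A S \<alpha>)"
    by (auto simp: jbasis_def jpairs_def jlevel_def)
  show "(\<Union>\<alpha>\<in>Collect (eigenvalue A). jbasis_at A S \<alpha>) \<subseteq> B"
    using jbasis_at_level by (fastforce simp: jbasis_def)
qed

lemma jbasis_at:
  assumes "eigenvalue A \<alpha>"
  shows "independent (jbasis_at A S \<alpha>)" "span (jbasis_at A S \<alpha>) = gen_eig A \<alpha>"
    "disjoint_family_on (chain A \<alpha>) (S \<alpha>)"
  using assms chains by (auto simp: jordan_chains_def gen_eigenspace_eq_gen_eig)

lemma jbasis_at_subset_gen_eig:
  assumes "eigenvalue A \<alpha>"
  shows "jbasis_at A S \<alpha> \<subseteq> gen_eig A \<alpha>"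
  using jbasis_at(2) [OF assms] span_superset by blast

lemma span_jbasis: "span B = UNIV"
proof -
  have "gen_eig A \<alpha> \<subseteq> span B" if "eigenvalue A \<alpha>" for \<alpha>
    unfolding jbasis_at(2) [OF that, symmetric] jbasis_eq
    using that by (intro span_mono) auto
  then have "span (\<Union>\<alpha>\<in>Collect (eigenvalue A). gen_eig A \<alpha>) \<subseteq> span B"
    by (intro span_minimal) auto
  then show ?thesis
    using span_gen_eig by auto
qed

lemma independent_jbasis: "independent B"
proof (rule independent_explicit_module [THEN iffD2], safe)
  fix t u b
  assume t: "finite t" "t \<subseteq> B" "(\<Sum>v\<in>t. u v *\<^sub>R v) = 0" "b \<in> t"
  \<comment> \<open>Each basis vector is assigned one eigenvalue, so that the fibres of
    \<open>ev\<close> partition \<open>t\<close> and the sum splits into vectors of distinct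
    generalized eigenspaces.\<close>
  define ev where "ev b = (SOME \<alpha>. eigenvalue A \<alpha> \<and> b \<in> jbasis_at A S \<alpha>)" for b
  have ev: "eigenvalue A (ev b)" "b \<in> jbasis_at A S (ev b)" if "b \<in> B" for b
  proof -
    have "\<exists>\<alpha>. eigenvalue A \<alpha> \<and> b \<in> jbasis_at A S \<alpha>"
      using that by (auto simp: jbasis_eq)
    then have "eigenvalue A (ev b) \<and> b \<in> jbasis_at A S (ev b)"
      unfolding ev_def by (rule someI_ex)
    then show "eigenvalue A (ev b)" "b \<in> jbasis_at A S (ev b)"
      by auto
  qed
  define w where "w \<alpha> = (\<Sum>v\<in>{v\<in>t. ev v = \<alpha>}. u v *\<^sub>R v)" for \<alpha>
  have "w (ev b) = 0"
  proof (rule gen_eig_sum_eq_0)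
    show "finite (ev ` t)"
      using t(1) by simp
    show "w \<alpha> \<in> gen_eig A \<alpha>" if "\<alpha> \<in> ev ` t" for \<alpha>
    proof -
      have "eigenvalue A \<alpha>"
        using that ev(1) t(2) by auto
      moreover have "w \<alpha> \<in> span (jbasis_at A S \<alpha>)"
        unfolding w_def using ev(2) t(2) by (intro span_sum span_scale span_base) auto
      ultimately show ?thesis
        by (simp add: jbasis_at(2))
    qed
    show "(\<Sum>\<alpha>\<in>ev ` t. w \<alpha>) = 0"
      using t(3) unfolding w_def sum.image_gen [OF t(1), of _ ev] .
    show "ev b \<in> ev ` t"
      using t(4) by simp
  qed
  then have "(\<Sum>v\<in>{v\<in>t. ev v = ev b}. u v *\<^sub>R v) = 0"
    by (simp add: w_def)
  moreover have "{v\<in>t. ev v = ev b} \<subseteq> jbasis_at A S (ev b)"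
    using ev(2) t(2) by force
  moreover have "independent (jbasis_at A S (ev b))"
    using ev(1) t jbasis_at(1) by blast
  ultimately show "u b = 0"
    using t by (intro independentD [of "jbasis_at A S (ev b)" "{v\<in>t. ev v = ev b}"]) auto
qed

lemma finite_jbasis: "finite B"
  by (rule independent_imp_finite [OF independent_jbasis])

text \<open>A nonzero vector of one generalized eigenspace is not killed by a power of A shifted by
  another number, so the eigenvalue is determined; the level is then the order of the
  vector.\<close>

lemma jlevel_unique:
  assumes "p \<in> jpairs A S" "q \<in> jpairs A S" "b \<in> jlevel A S p" "b \<in> jlevel A S q"
  shows "p = q"
proof -
  obtain \<alpha> l \<beta> k where pq: "p = (\<alpha>, l)" "q = (\<beta>, k)"
    by (metis surj_pair)
  note p = jlevelD [OF assms(3) [unfolded pq]] jpairsD [OF assms(1) [unfolded pq]]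
  note q = jlevelD [OF assms(4) [unfolded pq]] jpairsD [OF assms(2) [unfolded pq]]
  have "\<alpha> = \<beta>"
  proof (rule ccontr)
    assume "\<alpha> \<noteq> \<beta>"
    then have "b = 0"
      using gen_eig_shift_pow_inj [of b A \<beta> \<alpha> l] p(2) jbasis_at_subset_gen_eig [OF q(4)] q(1) by auto
    with p(3) show False
      by simp
  qed
  with mat_pow_eq_0_unique [OF p(2,3,5)] q show ?thesis
    by (simp add: pq)
qed

lemma jlevel_subset: "p \<in> jpairs A S \<Longrightarrow> jlevel A S p \<subseteq> B"
  by (auto simp: jbasis_def)

lemma jlevel_top_in_jbasis:
  assumes "(\<alpha>, l) \<in> jpairs A S" "b \<in> jlevel A S (\<alpha>, l)"
  shows "N \<alpha> (l - 1) b \<in> B"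
proof -
  note b = jlevelD [OF assms(2)] jpairsD [OF assms(1)]
  obtain v m k where *: "(v, m) \<in> S \<alpha>" "k < m" "b = N \<alpha> k v" "N \<alpha> (m - k) b = 0" "N \<alpha> (m - k - 1) b \<noteq> 0"
    "N \<alpha> (m - k - 1) b = N \<alpha> (m - 1) v"
    using chainE [OF b(4,1)] .
  have "l = m - k"
    using mat_pow_eq_0_unique [OF b(2,3,5) *(4,5)] *(2) by simp
  then have "N \<alpha> (l - 1) b = N \<alpha> (m - 1) v"
    using *(6) by simp
  moreover have "N \<alpha> (m - 1) v \<in> jbasis_at A S \<alpha>"
    using *(1,2) by (force simp: jbasis_at_def chain_def)
  ultimately show ?thesis
    using b(4) by (auto simp: jbasis_eq)
qed

text \<open>The image is the end of a chain. Disjointness of the chains makes it determine the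
  chain, and the level determines the position in the chain. Hence no coordinates of a block merge
  in the leading term of the flow.\<close>

lemma jlevel_top_inj:
  assumes "(\<alpha>, l) \<in> jpairs A S"
  shows "inj_on (N \<alpha> (l - 1)) (jlevel A S (\<alpha>, l))"
proof (rule inj_onI)
  fix b b' assume bb: "b \<in> jlevel A S (\<alpha>, l)" "b' \<in> jlevel A S (\<alpha>, l)" "N \<alpha> (l - 1) b = N \<alpha> (l - 1) b'"
  note b = jlevelD [OF bb(1)] jpairsD [OF assms(1)]
  note b' = jlevelD [OF bb(2)]
  obtain v m k where *: "(v, m) \<in> S \<alpha>" "k < m" "b = N \<alpha> k v" "N \<alpha> (m - k) b = 0" "N \<alpha> (m - k - 1) b \<noteq> 0"
    "N \<alpha> (m - k - 1) b = N \<alpha> (m - 1) v"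
    using chainE [OF b(4,1)] .
  obtain v' m' k' where c': "(v', m') \<in> S \<alpha>" "k' < m'" "b' = N \<alpha> k' v'" "N \<alpha> (m' - k') b' = 0" "N \<alpha> (m' - k' - 1) b' \<noteq> 0"
    "N \<alpha> (m' - k' - 1) b' = N \<alpha> (m' - 1) v'"
    using chainE [OF b(4) b'(1)] .
  have l: "l = m - k" "l = m' - k'"
    using mat_pow_eq_0_unique [OF b(2,3,5) *(4,5)] *(2) mat_pow_eq_0_unique [OF b'(2,3) b(5) c'(4,5)] c'(2)
    by simp_all
  have "N \<alpha> (m - 1) v \<in> chain A \<alpha> (v, m)" "N \<alpha> (m' - 1) v' \<in> chain A \<alpha> (v', m')"
    using *(2) c'(2) by (force simp: chain_def)+
  moreover have "N \<alpha> (m - 1) v = N \<alpha> (m' - 1) v'"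
  proof -
    have "N \<alpha> (m - 1) v = N \<alpha> (l - 1) b"
      by (simp only: *(6) [symmetric] l(1))
    also have "\<dots> = N \<alpha> (m' - 1) v'"
      unfolding bb(3) by (simp only: c'(6) [symmetric] l(2))
    finally show ?thesis .
  qed
  ultimately have "chain A \<alpha> (v, m) \<inter> chain A \<alpha> (v', m') \<noteq> {}"
    by auto
  then have "(v, m) = (v', m')"
    using jbasis_at(3) [OF b(4)] *(1) c'(1) by (metis disjoint_family_onD)
  with l *(2) c'(2) have "k = k'"
    by auto
  with \<open>(v, m) = (v', m')\<close> show "b = b'"
    using *(3) c'(3) by simp
qed

section \<open>The matrix exponential as a one-parameter group\<close>

definition flow :: "real \<Rightarrow> real^'n \<Rightarrow> real^'n" where
  "flow s v = mat_exp (s *\<^sub>R A) *v v"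

lemma flow_gen_eig:
  assumes "N \<alpha> m w = 0"
  shows "flow s w = exp (\<alpha> * s) *\<^sub>R exp_partial A \<alpha> m s w"
  using sums_unique2 [OF mat_exp_mult_sums exp_series_sums_gen_eig [OF assms]] span_gen_eig
  unfolding flow_def by blast

lemma linear_flow: "linear (flow s)"
  unfolding flow_def by (rule matrix_vector_mul_linear)

lemma jbasis_nilpotent:
  assumes "b \<in> B"
  shows "\<exists>\<alpha> m. 0 < \<alpha> \<and> N \<alpha> m b = 0"
  using assms eigenvalue_pos jlevelD(2) by (fastforce simp: jbasis_def jpairs_def)

lemma flow_add: "flow s (flow t v) = flow (s + t) v"
proof (rule linear_eq_on [of "\<lambda>v. flow s (flow t v)" "flow (s + t)" v B])
  show "linear (\<lambda>v. flow s (flow t v))"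
    using linear_compose [OF linear_flow [of t] linear_flow [of s]] by (simp add: comp_def)
  show "linear (flow (s + t))"
    by (rule linear_flow)
  show "v \<in> span B"
    by (simp add: span_jbasis)
  fix b assume "b \<in> B"
  then obtain \<alpha> m where m: "N \<alpha> m b = 0"
    using jbasis_nilpotent by blast
  have "flow s (flow t b) = exp (\<alpha> * t) *\<^sub>R (exp (\<alpha> * s) *\<^sub>R exp_partial A \<alpha> m s (exp_partial A \<alpha> m t b))"
    by (simp only: flow_gen_eig [OF m] linear_scale [OF linear_flow] flow_gen_eig [OF mat_pow_exp_partial [OF m]])
  also have "\<dots> = flow (s + t) b"
    by (simp add: exp_partial_add [OF m] flow_gen_eig [OF m] exp_add [symmetric] algebra_simps)
  finally show "flow s (flow t b) = flow (s + t) b" .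
qed

lemma flow_0: "flow 0 v = v"
proof (rule linear_eq_on [of "flow 0" "\<lambda>v. v" v B])
  fix b assume "b \<in> B"
  then obtain \<alpha> m where m: "N \<alpha> m b = 0"
    using jbasis_nilpotent by blast
  \<comment> \<open>The larger exponent guarantees a term at index 0, which is the only one left at
    time 0.\<close>
  then have "N \<alpha> (Suc m) b = 0"
    by (rule mat_pow_mult_eq_0_mono) simp
  then have "flow 0 b = exp_partial A \<alpha> (Suc m) 0 b"
    by (subst flow_gen_eig) auto
  also have "\<dots> = b"
    by (simp add: exp_partial_def sum.lessThan_Suc_shift del: sum.lessThan_Suc)
  finally show "flow 0 b = b" .
qed (simp_all add: span_jbasis linear_flow linear_ident)

lemma continuous_flow: "continuous_on UNIV (\<lambda>s. flow s v)"
proof -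
  have "v \<in> span B"
    by (simp add: span_jbasis)
  then show ?thesis
  proof (rule span_induct)
    show "subspace {v. continuous_on UNIV (\<lambda>s. flow s v)}"
      by (rule subspaceI)
        (auto simp: linear_0 [OF linear_flow] linear_add [OF linear_flow] linear_scale [OF linear_flow]
          intro!: continuous_on_const continuous_on_add continuous_on_scaleR)
  next
    fix b assume "b \<in> B"
    then obtain \<alpha> m where m: "N \<alpha> m b = 0"
      using jbasis_nilpotent by blast
    show "continuous_on UNIV (\<lambda>s. flow s b)"
      unfolding flow_gen_eig [OF m] exp_partial_def by (intro continuous_intros) auto
  qed
qed

end

text \<open>Half of the decay rate is spent on the power of \<open>s\<close>, using that (c s)^j /
  j! is a single term of the series of e^(c s).\<close>

lemma exp_power_bound:
  fixes \<alpha> c s :: real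
  assumes "0 < c" "2 * c \<le> \<alpha>" "0 \<le> s"
  shows "exp (- \<alpha> * s) * (s ^ j / fact j) \<le> exp (- c * s) / c ^ j"
proof -
  have "(c * s) ^ j / fact j \<le> exp (c * s)"
  proof -
    have "(\<lambda>n. (c * s) ^ n /\<^sub>R fact n) sums exp (c * s)"
      by (rule exp_converges)
    then show ?thesis
      using sum_le_suminf [of "\<lambda>n. (c * s) ^ n /\<^sub>R fact n" "{j}"] assms
      by (simp add: sums_iff divide_inverse mult.commute)
  qed
  then have "s ^ j / fact j \<le> exp (c * s) / c ^ j"
    using assms(1) by (simp add: power_mult_distrib field_simps)
  then have "exp (- \<alpha> * s) * (s ^ j / fact j) \<le> exp (- (2 * c) * s) * (exp (c * s) / c ^ j)"
    using assms by (intro mult_mono) (auto intro: mult_right_mono)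
  also have "\<dots> = exp (- c * s) / c ^ j"
    by (simp add: exp_add [symmetric])
  finally show ?thesis .
qed

context jordan_data
begin

lemma flow_jbasis_contract:
  assumes "0 < c" "2 * c \<le> \<alpha>" "N \<alpha> m b = 0" "0 \<le> s"
  shows "norm (flow (- s) b) \<le> (\<Sum>j<m. norm (N \<alpha> j b) / c ^ j) * exp (- c * s)"
proof -
  have "norm (flow (- s) b) \<le> (\<Sum>j<m. norm ((exp (- \<alpha> * s) * ((- s) ^ j / fact j)) *\<^sub>R N \<alpha> j b))"
    unfolding flow_gen_eig [OF assms(3)] exp_partial_def scaleR_sum_right scaleR_scaleR
    by (rule order_trans [OF norm_sum]) simp
  also have "\<dots> \<le> (\<Sum>j<m. norm (N \<alpha> j b) / c ^ j * exp (- c * s))"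
  proof (rule sum_mono)
    fix j
    have "\<bar>exp (- \<alpha> * s) * ((- s) ^ j / fact j)\<bar> = exp (- \<alpha> * s) * (s ^ j / fact j)"
      using assms(4) by (simp add: abs_mult power_abs)
    also have "\<dots> \<le> exp (- c * s) / c ^ j"
      by (rule exp_power_bound [OF assms(1,2,4)])
    finally have "\<bar>exp (- \<alpha> * s) * ((- s) ^ j / fact j)\<bar> * norm (N \<alpha> j b) \<le> exp (- c * s) / c ^ j * norm (N \<alpha> j b)"
      by (rule mult_right_mono) simp
    also have "\<dots> = norm (N \<alpha> j b) / c ^ j * exp (- c * s)"
      by simp
    finally show "norm ((exp (- \<alpha> * s) * ((- s) ^ j / fact j)) *\<^sub>R N \<alpha> j b) \<le> norm (N \<alpha> j b) / c ^ j * exp (- c * s)"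
      by (simp only: norm_scaleR)
  qed
  finally show ?thesis
    by (simp add: sum_distrib_right)
qed

lemma representation_jbasis:
  "representation B (v + w) b = representation B v b + representation B w b"
  "representation B (v - w) b = representation B v b - representation B w b"
  "representation B (c *\<^sub>R v) b = c * representation B v b"
  by (simp_all add: representation_add representation_diff representation_scale independent_jbasis span_jbasis)

lemma bounded_linear_representation: "bounded_linear (\<lambda>v. representation B v b)"
  by (intro linear_conv_bounded_linear [THEN iffD1] linearI) (simp_all add: representation_jbasis)

lemma flow_contracting:
  "\<exists>C c. 0 < c \<and> (\<forall>s\<ge>0. \<forall>v. norm (flow (- s) v) \<le> C * exp (- c * s) * norm v)"
proof -
  obtain \<alpha> m where \<alpha>: "0 < \<alpha> b \<and> N (\<alpha> b) (m b) b = 0" if "b \<in> B" for b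
    using jbasis_nilpotent by metis
  \<comment> \<open>Half of a lower bound for the rates at all basis vectors; the other half absorbs
    the polynomial factors.\<close>
  define c where "c = Min (insert 1 (\<alpha> ` B)) / 2"
  have "0 < c"
    unfolding c_def using finite_jbasis \<alpha> by auto
  have c: "2 * c \<le> \<alpha> b" if "b \<in> B" for b
    unfolding c_def using finite_jbasis that by auto
  define K where "K b = (\<Sum>j<m b. norm (N (\<alpha> b) j b) / c ^ j)" for b
  have K: "norm (flow (- s) b) \<le> K b * exp (- c * s)" if "b \<in> B" "0 \<le> s" for b s
    unfolding K_def using flow_jbasis_contract [OF \<open>0 < c\<close> c] \<alpha> that by blast
  have "\<exists>R. \<forall>v. norm (representation B v b) \<le> norm v * R" for b
    using bounded_linear.bounded [OF bounded_linear_representation] by blast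
  then obtain R where R: "\<bar>representation B v b\<bar> \<le> norm v * R b" for v b
    by (metis real_norm_def)
  have "norm (flow (- s) v) \<le> (\<Sum>b\<in>B. R b * K b) * exp (- c * s) * norm v" if "0 \<le> s" for s v
  proof -
    have "flow (- s) v = flow (- s) (\<Sum>b\<in>B. representation B v b *\<^sub>R b)"
      using sum_representation_eq [OF independent_jbasis, of v B] finite_jbasis span_jbasis by simp
    also have "\<dots> = (\<Sum>b\<in>B. representation B v b *\<^sub>R flow (- s) b)"
      by (simp add: linear_sum [OF linear_flow] linear_scale [OF linear_flow])
    also have "norm \<dots> \<le> (\<Sum>b\<in>B. (norm v * R b) * (K b * exp (- c * s)))"
    proof (rule sum_norm_le)
      fix b assume "b \<in> B"
      have "norm (representation B v b *\<^sub>R flow (- s) b) = \<bar>representation B v b\<bar> * norm (flow (- s) b)"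
        by simp
      also have "\<dots> \<le> (norm v * R b) * (K b * exp (- c * s))"
        using R [of v b] K [OF \<open>b \<in> B\<close> that] by (intro mult_mono) (auto intro: order_trans [OF abs_ge_zero])
      finally show "norm (representation B v b *\<^sub>R flow (- s) b) \<le> (norm v * R b) * (K b * exp (- c * s))" .
    qed
    finally show ?thesis
      by (simp add: sum_distrib_left sum_distrib_right mult_ac)
  qed
  with \<open>0 < c\<close> show ?thesis
    by blast
qed

end

section \<open>Boundary metrics of expanding flows\<close>

lemma exp_decay_below:
  fixes c \<epsilon> K :: real
  assumes "0 < c" "0 < \<epsilon>"
  shows "\<exists>s0\<ge>0. \<forall>s\<ge>s0. K * exp (- c * s) < \<epsilon>"
proof (intro exI conjI allI impI)
  show "0 \<le> \<bar>K\<bar> / (c * \<epsilon>)"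
    using assms by simp
  fix s assume "\<bar>K\<bar> / (c * \<epsilon>) \<le> s"
  then have "\<bar>K\<bar> \<le> (c * s) * \<epsilon>"
    using assms by (simp add: field_simps)
  also have "\<dots> < exp (c * s) * \<epsilon>"
  proof (rule mult_strict_right_mono)
    show "c * s < exp (c * s)"
      using exp_ge_add_one_self [of "c * s"] by linarith
  qed (rule assms)
  finally show "K * exp (- c * s) < \<epsilon>"
    using assms by (simp add: exp_minus field_simps)
qed

text \<open>The metric arguments need only a linear one-parameter group that contracts in backward
  time and a norm equivalent to the Euclidean one, so they are separated from Jordan coordinates.
  Homogeneity is assumed as an inequality; applied to \<open>a\<close> and to \<open>1 / a\<close>
  it becomes an equality.\<close>

locale expanding_flow =
  fixes E :: "real \<Rightarrow> 'a::euclidean_space \<Rightarrow> 'a" and \<nu> :: "'a \<Rightarrow> real"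
  assumes linear_E: "linear (E s)"
    and E_add: "E s (E t v) = E (s + t) v"
    and E_0: "E 0 v = v"
    and continuous_E: "continuous_on UNIV (\<lambda>s. E s v)"
    and contracting: "\<exists>C c. 0 < c \<and> (\<forall>s\<ge>0. \<forall>v. norm (E (- s) v) \<le> C * exp (- c * s) * norm v)"
    and \<nu>_nonneg: "0 \<le> \<nu> v"
    and \<nu>_triangle: "\<nu> (v + w) \<le> \<nu> v + \<nu> w"
    and \<nu>_scale_le: "\<nu> (a *\<^sub>R v) \<le> \<bar>a\<bar> * \<nu> v"
    and \<nu>_le_norm: "\<exists>c>0. \<forall>v. \<nu> v \<le> c * norm v"
    and norm_le_\<nu>: "\<exists>c>0. \<forall>v. norm v \<le> c * \<nu> v"
begin

definition gauge :: "'a \<Rightarrow> 'a \<Rightarrow> real" where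
  "gauge p q = (if p = q then 0 else exp (LEAST t. \<nu> (E (- t) (p - q)) \<le> 1))"

lemma \<nu>_scale: "\<nu> (a *\<^sub>R v) = \<bar>a\<bar> * \<nu> v"
proof (cases "a = 0")
  case True
  then show ?thesis
    using \<nu>_scale_le [of 0 v] \<nu>_nonneg [of "0 *\<^sub>R v"] by simp
next
  case False
  then have "\<nu> v \<le> \<bar>1 / a\<bar> * \<nu> (a *\<^sub>R v)"
    using \<nu>_scale_le [of "1 / a" "a *\<^sub>R v"] by simp
  with False have "\<bar>a\<bar> * \<nu> v \<le> \<nu> (a *\<^sub>R v)"
    by (simp add: field_simps abs_divide)
  with \<nu>_scale_le [of a v] show ?thesis
    by simp
qed

lemma \<nu>_0: "\<nu> 0 = 0"
  using \<nu>_scale [of 0 0] by simp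

lemma \<nu>_sum: "\<nu> (\<Sum>i\<in>I. f i) \<le> (\<Sum>i\<in>I. \<nu> (f i))"
proof (induction I rule: infinite_finite_induct)
  case (insert i I)
  then show ?case
    using \<nu>_triangle [of "f i" "\<Sum>i\<in>I. f i"] by simp
qed (simp_all add: \<nu>_0)

lemma \<nu>_diff_le: "\<bar>\<nu> v - \<nu> w\<bar> \<le> \<nu> (v - w)"
proof -
  have "\<nu> (w - v) = \<nu> (v - w)"
    using \<nu>_scale [of "- 1" "v - w"] by simp
  then show ?thesis
    using \<nu>_triangle [of "v - w" w] \<nu>_triangle [of "w - v" v] by auto
qed

lemma \<nu>_pos: "v \<noteq> 0 \<Longrightarrow> 0 < \<nu> v"
proof -
  assume "v \<noteq> 0"
  obtain c where "norm v \<le> c * \<nu> v"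
    using norm_le_\<nu> by blast
  with \<open>v \<noteq> 0\<close> \<nu>_nonneg [of v] show ?thesis
    by (cases "\<nu> v = 0") auto
qed

lemma continuous_\<nu>: "continuous_on UNIV \<nu>"
proof -
  obtain c where c: "0 < c" "\<And>v. \<nu> v \<le> c * norm v"
    using \<nu>_le_norm by blast
  show ?thesis
  proof (rule continuous_onI)
    fix x and e :: real assume "0 < e"
    show "\<exists>d>0. \<forall>x'\<in>UNIV. dist x' x < d \<longrightarrow> dist (\<nu> x') (\<nu> x) \<le> e"
    proof (intro exI conjI ballI impI)
      show "0 < e / c"
        using c \<open>0 < e\<close> by simp
      fix x' assume "dist x' x < e / c"
      then have "c * norm (x' - x) \<le> e"
        using c(1) by (simp add: dist_norm field_simps)
      then show "dist (\<nu> x') (\<nu> x) \<le> e"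
        using \<nu>_diff_le [of x' x] c(2) [of "x' - x"] by (simp add: dist_real_def)
    qed
  qed
qed

lemma \<nu>_contracting:
  obtains C c where "0 < C" "0 < c" "\<And>s v. 0 \<le> s \<Longrightarrow> \<nu> (E (- s) v) \<le> C * exp (- c * s) * \<nu> v"
proof -
  obtain D c where c: "0 < c" "\<And>s v. 0 \<le> s \<Longrightarrow> norm (E (- s) v) \<le> D * exp (- c * s) * norm v"
    using contracting by blast
  obtain a where a: "0 < a" "\<And>v. \<nu> v \<le> a * norm v"
    using \<nu>_le_norm by blast
  obtain b where b: "0 < b" "\<And>v. norm v \<le> b * \<nu> v"
    using norm_le_\<nu> by blast
  show thesis
  proof
    \<comment> \<open>The sign of \<open>D\<close> is unknown, so it is replaced by a larger
      constant that is certainly positive.\<close>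
    show "0 < a * (\<bar>D\<bar> + 1) * b"
      using a b by simp
    fix s v assume s: "0 \<le> (s :: real)"
    have "\<nu> (E (- s) v) \<le> a * (D * exp (- c * s) * norm v)"
      using a c(2) [OF s, of v] by (meson mult_left_mono order_trans less_imp_le)
    also have "\<dots> \<le> a * ((\<bar>D\<bar> + 1) * exp (- c * s) * (b * \<nu> v))"
      using a b by (intro mult_left_mono mult_mono) auto
    finally show "\<nu> (E (- s) v) \<le> a * (\<bar>D\<bar> + 1) * b * exp (- c * s) * \<nu> v"
      by (simp add: mult_ac)
  qed (rule c(1))
qed

lemma \<nu>_E_bounded:
  obtains C where "0 < C" "\<And>v. \<nu> (E k v) \<le> C * \<nu> v"
proof -
  obtain a where a: "0 < a" "\<And>v. \<nu> v \<le> a * norm v"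
    using \<nu>_le_norm by blast
  obtain b where b: "0 < b" "\<And>v. norm v \<le> b * \<nu> v"
    using norm_le_\<nu> by blast
  obtain D where D: "0 < D" "\<And>v. norm (E k v) \<le> norm v * D"
    using bounded_linear.pos_bounded linear_conv_bounded_linear linear_E by metis
  show thesis
  proof
    show "0 < a * (D * b)"
      using a b D by simp
    fix v
    have "\<nu> (E k v) \<le> a * (norm v * D)"
      using a D(2) [of v] by (meson mult_left_mono order_trans less_imp_le)
    also have "\<dots> \<le> a * ((b * \<nu> v) * D)"
      using a b D by (intro mult_left_mono mult_right_mono) auto
    finally show "\<nu> (E k v) \<le> a * (D * b) * \<nu> v"
      by (simp add: mult_ac)
  qed
qed

lemma E_cancel: "E (- t) (E t v) = v" "E t (E (- t) v) = v"
  by (simp_all add: E_add E_0)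

text \<open>\<open>LEAST\<close> on the reals is informative only if the minimum is attained. The
  condition is closed in \<open>t\<close>, holds for large \<open>t\<close> by contraction, and
  fails for very negative \<open>t\<close>, where contracting \<open>E (- t) v\<close> back to
  \<open>v\<close> would make \<open>v\<close> too small.\<close>

lemma hitting_time:
  assumes "v \<noteq> 0"
  shows "\<nu> (E (- (LEAST t. \<nu> (E (- t) v) \<le> 1)) v) \<le> 1"
    and "\<nu> (E (- t) v) \<le> 1 \<Longrightarrow> (LEAST t. \<nu> (E (- t) v) \<le> 1) \<le> t"
proof -
  obtain C c where C: "0 < C" "0 < c" "\<And>s v. 0 \<le> s \<Longrightarrow> \<nu> (E (- s) v) \<le> C * exp (- c * s) * \<nu> v"
    by (rule \<nu>_contracting) blast
  define T where "T = {t. \<nu> (E (- t) v) \<le> 1}"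
  obtain s0 where s0: "0 \<le> s0" "C * \<nu> v * exp (- c * s0) < 1"
    using exp_decay_below [OF C(2), of 1 "C * \<nu> v"] by auto
  have "s0 \<in> T"
    using C(3) [OF s0(1), of v] s0(2) by (simp add: T_def mult_ac)
  obtain s1 where s1: "0 \<le> s1" "\<And>s. s1 \<le> s \<Longrightarrow> C * exp (- c * s) < \<nu> v"
    using exp_decay_below [OF C(2) \<nu>_pos [OF assms], of C] by blast
  have "- s1 \<le> t" if "t \<in> T" for t
  proof (rule ccontr)
    assume "\<not> - s1 \<le> t"
    then have "s1 \<le> - t"
      by simp
    then have "\<nu> v \<le> C * exp (- c * (- t)) * \<nu> (E (- t) v)"
      using C(3) [of "- t" "E (- t) v"] s1(1) by (simp add: E_cancel)
    also have "\<dots> \<le> C * exp (- c * (- t)) * 1"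
      using that C(1) by (intro mult_left_mono) (auto simp: T_def)
    finally show False
      using s1(2) [OF \<open>s1 \<le> - t\<close>] by simp
  qed
  then have bdd: "bdd_below T"
    by (rule bdd_belowI)
  have "continuous_on UNIV (\<lambda>t. \<nu> (E (- t) v))"
    by (intro continuous_on_compose2 [OF continuous_\<nu>] continuous_on_compose2 [OF continuous_E] continuous_intros) auto
  then have "closed T"
    unfolding T_def by (rule closed_Collect_le) (rule continuous_on_const)
  then have Inf: "Inf T \<in> T"
    using closed_contains_Inf \<open>s0 \<in> T\<close> bdd by blast
  moreover have "Inf T \<le> t" if "t \<in> T" for t
    using that bdd by (rule cInf_lower)
  ultimately have "(LEAST t. \<nu> (E (- t) v) \<le> 1) = Inf T"
    by (intro Least_equality) (auto simp: T_def)
  then show "\<nu> (E (- (LEAST t. \<nu> (E (- t) v) \<le> 1)) v) \<le> 1"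
    and "\<nu> (E (- t) v) \<le> 1 \<Longrightarrow> (LEAST t. \<nu> (E (- t) v) \<le> 1) \<le> t"
    using Inf \<open>\<And>t. t \<in> T \<Longrightarrow> Inf T \<le> t\<close> by (auto simp: T_def)
qed

lemma gauge_le_exp:
  assumes "\<nu> (E (- t) (p - q)) \<le> 1"
  shows "gauge p q \<le> exp t"
  using hitting_time(2) [of "p - q" t] assms by (auto simp: gauge_def)

text \<open>After the hitting time the size need not decrease: polynomial factors from nilpotent
  parts can lift it above 1 again. The contraction estimate started at the hitting time bounds this
  overshoot, so \<open>gauge_le_exp\<close> has a converse up to a constant.\<close>

lemma \<nu>_le_if_gauge_le_exp:
  obtains C where "0 < C" "\<And>p q t. gauge p q \<le> exp t \<Longrightarrow> \<nu> (E (- t) (p - q)) \<le> C"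
proof -
  obtain C c where C: "0 < C" "0 < c" "\<And>s v. 0 \<le> s \<Longrightarrow> \<nu> (E (- s) v) \<le> C * exp (- c * s) * \<nu> v"
    by (rule \<nu>_contracting) blast
  show thesis
  proof
    fix p q t assume *: "gauge p q \<le> exp t"
    show "\<nu> (E (- t) (p - q)) \<le> C"
    proof (cases "p = q")
      case True
      then show ?thesis
        using C(1) by (simp add: linear_0 [OF linear_E] \<nu>_0)
    next
      case False
      define \<tau> where "\<tau> = (LEAST t. \<nu> (E (- t) (p - q)) \<le> 1)"
      have \<tau>: "\<nu> (E (- \<tau>) (p - q)) \<le> 1" "\<tau> \<le> t"
        using hitting_time(1) [of "p - q"] * False by (simp_all add: \<tau>_def gauge_def)
      have "\<nu> (E (- t) (p - q)) = \<nu> (E (- (t - \<tau>)) (E (- \<tau>) (p - q)))"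
        by (simp add: E_add)
      also have "\<dots> \<le> C * exp (- c * (t - \<tau>)) * \<nu> (E (- \<tau>) (p - q))"
        using \<tau> by (intro C) simp
      also have "\<dots> \<le> C * 1 * 1"
        using \<tau> C by (intro mult_mono) (auto simp: \<nu>_nonneg)
      finally show ?thesis
        by simp
    qed
  qed (rule C(1))
qed

lemma gauge_self: "gauge p q = 0 \<longleftrightarrow> p = q"
  by (simp add: gauge_def)

text \<open>A factor \<open>K\<close> in the metric shifts the scale by ln K, and the fixed linear
  map \<open>E (ln K)\<close> returns to scale \<open>t\<close> at the cost of a constant.\<close>

lemma lipschitz_unit_scale:
  assumes "0 < K" "\<And>p q. gauge (F p) (F q) \<le> K * gauge p q"
  obtains C where "0 < C" "\<And>t p q. \<nu> (E (- t) (p - q)) \<le> 1 \<Longrightarrow> \<nu> (E (- t) (F p - F q)) \<le> C"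
proof -
  obtain C1 where C1: "0 < C1" "\<And>p q t. gauge p q \<le> exp t \<Longrightarrow> \<nu> (E (- t) (p - q)) \<le> C1"
    by (rule \<nu>_le_if_gauge_le_exp) blast
  obtain C2 where C2: "0 < C2" "\<And>v. \<nu> (E (ln K) v) \<le> C2 * \<nu> v"
    by (rule \<nu>_E_bounded) blast
  show thesis
  proof
    fix t p q assume "\<nu> (E (- t) (p - q)) \<le> 1"
    then have "gauge p q \<le> exp t"
      by (rule gauge_le_exp)
    then have "K * gauge p q \<le> exp (t + ln K)"
      using assms(1) by (simp add: exp_add)
    then have *: "\<nu> (E (- (t + ln K)) (F p - F q)) \<le> C1"
      using assms(2) [of p q] by (intro C1) simp
    have "\<nu> (E (- t) (F p - F q)) = \<nu> (E (ln K) (E (- (t + ln K)) (F p - F q)))"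
      by (simp add: E_add)
    also have "\<dots> \<le> C2 * \<nu> (E (- (t + ln K)) (F p - F q))"
      by (rule C2(2))
    also have "\<dots> \<le> C2 * C1"
      using * C2(1) by (intro mult_left_mono) auto
    finally show "\<nu> (E (- t) (F p - F q)) \<le> C2 * C1" .
  qed (use C1 C2 in simp)
qed

text \<open>The segment from \<open>p\<close> to \<open>q\<close> is cut into pieces that have unit size at scale \<open>t\<close>, so that
  \<^term>\<open>F\<close>, seen at scale \<open>t\<close>, is Lipschitz at large distances with a constant independent of \<open>t\<close>.\<close>

lemma lipschitz_every_scale:
  assumes "0 < K" "\<And>p q. gauge (F p) (F q) \<le> K * gauge p q"
  obtains C where "0 < C" "\<And>t p q. \<nu> (E (- t) (F p - F q)) \<le> C * (1 + \<nu> (E (- t) (p - q)))"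
proof -
  obtain C where C: "0 < C" "\<And>t p q. \<nu> (E (- t) (p - q)) \<le> 1 \<Longrightarrow> \<nu> (E (- t) (F p - F q)) \<le> C"
    using lipschitz_unit_scale [of K F, OF assms] by blast
  show thesis
  proof
    fix t p q
    define x where "x = \<nu> (E (- t) (p - q))"
    have "0 \<le> x"
      by (simp add: x_def \<nu>_nonneg)
    \<comment> \<open>The extra 1 keeps \<open>n\<close> positive even for p = q; the bound x + 2
      that results is the origin of the factor 2 in the constant.\<close>
    define n where "n = nat \<lceil>x\<rceil> + 1"
    have n: "0 < n" "x \<le> real n" "real n \<le> x + 2"
      using \<open>0 \<le> x\<close> unfolding n_def by linarith+
    define P where "P j = p + (real j / real n) *\<^sub>R (q - p)" for j
    have P: "P j - P (Suc j) = (1 / real n) *\<^sub>R (p - q)" for j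
      using n(1) by (simp add: P_def add_divide_distrib algebra_simps)
    have "\<nu> (E (- t) (P j - P (Suc j))) \<le> 1" for j
      unfolding P linear_scale [OF linear_E] \<nu>_scale x_def [symmetric] using n by simp
    then have *: "\<nu> (E (- t) (F (P j) - F (P (Suc j)))) \<le> C" for j
      by (rule C(2))
    have "P 0 = p" "P n = q"
      using n(1) by (simp_all add: P_def)
    then have "F p - F q = (\<Sum>j<n. F (P j) - F (P (Suc j)))"
      using sum_lessThan_telescope' [of "\<lambda>j. F (P j)" n] by simp
    then have "\<nu> (E (- t) (F p - F q)) \<le> (\<Sum>j<n. \<nu> (E (- t) (F (P j) - F (P (Suc j)))))"
      by (simp only: linear_sum [OF linear_E] \<nu>_sum)
    also have "\<dots> \<le> real n * C"
      using sum_mono [of "{..<n}", OF *] by simp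
    also have "\<dots> \<le> (x + 2) * C"
      using n C(1) by (intro mult_right_mono) auto
    also have "\<dots> \<le> 2 * C * (1 + x)"
      using mult_nonneg_nonneg [OF \<open>0 \<le> x\<close> less_imp_le [OF C(1)]] by (simp add: algebra_simps)
    finally show "\<nu> (E (- t) (F p - F q)) \<le> 2 * C * (1 + \<nu> (E (- t) (p - q)))"
      by (simp add: x_def)
  qed (use C in simp)
qed

lemma lipschitz_imp_continuous:
  assumes "0 < K" "\<And>p q. gauge (F p) (F q) \<le> K * gauge p q"
  shows "continuous_on UNIV F"
proof (rule continuous_onI)
  fix p and e :: real assume "0 < e"
  obtain C1 where C1: "0 < C1" "\<And>t p q. \<nu> (E (- t) (p - q)) \<le> 1 \<Longrightarrow> \<nu> (E (- t) (F p - F q)) \<le> C1"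
    using lipschitz_unit_scale [of K F, OF assms] by blast
  obtain C c where C: "0 < C" "0 < c" "\<And>s v. 0 \<le> s \<Longrightarrow> \<nu> (E (- s) v) \<le> C * exp (- c * s) * \<nu> v"
    by (rule \<nu>_contracting) blast
  obtain a where a: "0 < a" "\<And>v. \<nu> v \<le> a * norm v"
    using \<nu>_le_norm by blast
  obtain b where b: "0 < b" "\<And>v. norm v \<le> b * \<nu> v"
    using norm_le_\<nu> by blast
  \<comment> \<open>A difference of bounded size at scale \<open>- s\<close> has actual size at most
    a constant times e^(-c s), so \<open>s\<close> is taken large enough to bring this below
    \<open>e\<close>.\<close>
  obtain s where s: "0 \<le> s" "b * C * C1 * exp (- c * s) < e"
    using exp_decay_below [OF C(2) \<open>0 < e\<close>] by blast
  obtain D where D: "0 < D" "\<And>v. \<nu> (E s v) \<le> D * \<nu> v"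
    by (rule \<nu>_E_bounded) blast
  show "\<exists>d>0. \<forall>q\<in>UNIV. dist q p < d \<longrightarrow> dist (F q) (F p) \<le> e"
  proof (intro exI conjI ballI impI)
    show "0 < 1 / (D * a)"
      using D a by simp
    fix q assume "dist q p < 1 / (D * a)"
    then have "D * (a * norm (q - p)) \<le> 1"
      using D a by (simp add: dist_norm field_simps)
    moreover have "\<nu> (E s (q - p)) \<le> D * (a * norm (q - p))"
      using D a(2) [of "q - p"] by (meson mult_left_mono order_trans less_imp_le)
    ultimately have "\<nu> (E s (F q - F p)) \<le> C1"
      using C1(2) [of "- s" q p] by simp
    then have "C * exp (- c * s) * \<nu> (E s (F q - F p)) \<le> C * exp (- c * s) * C1"
      using C by (intro mult_left_mono) auto
    then have "\<nu> (F q - F p) \<le> C * exp (- c * s) * C1"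
      using C(3) [OF s(1), of "E s (F q - F p)"] by (simp add: E_cancel)
    then have "b * \<nu> (F q - F p) \<le> b * (C * exp (- c * s) * C1)"
      using b by (intro mult_left_mono) auto
    then show "dist (F q) (F p) \<le> e"
      using b(2) [of "F q - F p"] s(2) by (simp add: dist_norm mult_ac)
  qed
qed

text \<open>A bound on the image distance gives a time, the same for all \<open>p\<close>, after
  which the backward flow has shrunk it to unit size. The metric inequality converts this into such
  a time for \<open>p\<close>, and the flow over a fixed time distorts sizes by a bounded
  factor.\<close>

lemma bounded_preimage:
  assumes "0 < K" "\<And>p q. gauge p q \<le> K * gauge (F p) (F q)"
  shows "\<exists>R'. \<forall>p. norm (F p - F 0) \<le> R \<longrightarrow> norm p \<le> R'"
proof -
  obtain C c where C: "0 < C" "0 < c" "\<And>s v. 0 \<le> s \<Longrightarrow> \<nu> (E (- s) v) \<le> C * exp (- c * s) * \<nu> v"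
    by (rule \<nu>_contracting) blast
  obtain a where a: "0 < a" "\<And>v. \<nu> v \<le> a * norm v"
    using \<nu>_le_norm by blast
  obtain b where b: "0 < b" "\<And>v. norm v \<le> b * \<nu> v"
    using norm_le_\<nu> by blast
  obtain s where s: "0 \<le> s" "C * (a * R) * exp (- c * s) < 1"
    using exp_decay_below [OF C(2), of 1] by auto
  obtain C1 where C1: "0 < C1" "\<And>p q t. gauge p q \<le> exp t \<Longrightarrow> \<nu> (E (- t) (p - q)) \<le> C1"
    by (rule \<nu>_le_if_gauge_le_exp) blast
  obtain D where D: "0 < D" "\<And>v. \<nu> (E (s + ln K) v) \<le> D * \<nu> v"
    by (rule \<nu>_E_bounded) blast
  have "norm p \<le> b * (D * C1)" if "norm (F p - F 0) \<le> R" for p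
  proof -
    have "\<nu> (F p - F 0) \<le> a * R"
      using a(2) [of "F p - F 0"] that a(1) by (meson mult_left_mono order_trans less_imp_le)
    then have "C * exp (- c * s) * \<nu> (F p - F 0) \<le> C * exp (- c * s) * (a * R)"
      using C by (intro mult_left_mono) auto
    then have "\<nu> (E (- s) (F p - F 0)) \<le> 1"
      using C(3) [OF s(1), of "F p - F 0"] s(2) by (simp add: mult_ac)
    then have "gauge (F p) (F 0) \<le> exp s"
      by (rule gauge_le_exp)
    then have "K * gauge (F p) (F 0) \<le> exp (s + ln K)"
      using assms(1) by (simp add: exp_add)
    then have "\<nu> (E (- (s + ln K)) p) \<le> C1"
      using assms(2) [of p 0] C1(2) [of p 0 "s + ln K"] by simp
    then have "D * \<nu> (E (- (s + ln K)) p) \<le> D * C1"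
      using D by (intro mult_left_mono) auto
    then have "\<nu> p \<le> D * C1"
      using D(2) [of "E (- (s + ln K)) p"] E_cancel(2) [of "s + ln K" p] by simp
    then have "b * \<nu> p \<le> b * (D * C1)"
      using b by (intro mult_left_mono) auto
    then show ?thesis
      using b(2) [of p] by simp
  qed
  then show ?thesis
    by blast
qed

lemma bilipschitz_imp_bij:
  assumes "0 < K" "\<And>p q. gauge (F p) (F q) \<le> K * gauge p q" "\<And>p q. gauge p q \<le> K * gauge (F p) (F q)"
  shows "bij F"
proof -
  have cont: "continuous_on UNIV F"
    using lipschitz_imp_continuous assms by blast
  have inj: "inj F"
  proof (rule injI)
    fix p q assume "F p = F q"
    then have "gauge p q \<le> 0"
      using assms(3) [of p q] gauge_self [of "F p" "F q"] by simp
    then show "p = q"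
      by (auto simp: gauge_def split: if_splits)
  qed
  have "open (range F)"
    by (rule invariance_of_domain_gen) (use cont inj in auto)
  \<comment> \<open>Preimages of a convergent sequence are bounded, so a subsequence of them
    converges, and continuity maps its limit to \<open>l\<close>.\<close>
  moreover have "closed (range F)"
    unfolding closed_sequential_limits
  proof (intro allI impI)
    fix y l assume y: "(\<forall>n. y n \<in> range F) \<and> y \<longlonglongrightarrow> l"
    then obtain x where x: "\<And>n. y n = F (x n)"
      by (auto simp: image_iff) metis
    have "bounded (range y)"
      using y by (intro convergent_imp_bounded) auto
    then obtain R where R: "\<And>n. norm (y n) \<le> R"
      by (auto simp: bounded_iff)
    have "norm (F (x n) - F 0) \<le> R + norm (F 0)" for n
      using R [of n] norm_triangle_ineq4 [of "F (x n)" "F 0"] by (simp add: x)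
    then obtain R' where "\<And>n. norm (x n) \<le> R'"
      using bounded_preimage [OF assms(1,3)] by blast
    then have "\<forall>n. x n \<in> cball 0 R'"
      by (simp add: dist_norm)
    then obtain z \<rho> where z: "strict_mono (\<rho> :: nat \<Rightarrow> nat)" "(x \<circ> \<rho>) \<longlonglongrightarrow> z"
      using compact_cball [of 0 R'] unfolding compact_def by blast
    have "(\<lambda>n. F ((x \<circ> \<rho>) n)) \<longlonglongrightarrow> F z"
      using cont z(2) by (metis UNIV_I continuous_on_eq_continuous_at isCont_tendsto_compose open_UNIV)
    moreover have "(\<lambda>n. F ((x \<circ> \<rho>) n)) \<longlonglongrightarrow> l"
      using LIMSEQ_subseq_LIMSEQ [OF conjunct2 [OF y] z(1)] by (simp add: x o_def)
    ultimately show "l \<in> range F"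
      using LIMSEQ_unique by blast
  qed
  ultimately have "range F = UNIV"
    using clopen by blast
  with inj show ?thesis
    by (simp add: bij_def)
qed

end

section \<open>Growth rates of blocks\<close>

text \<open>The exponents decide if they differ; if they agree, the powers of \<open>s\<close> do.
  This is the lexicographic order on the pairs seen as an order of growth.\<close>

lemma growth_coefficient_tendsto:
  fixes \<alpha> \<beta> :: real
  assumes "\<beta> < \<alpha> \<or> \<beta> = \<alpha> \<and> j \<le> m"
  shows "((\<lambda>s. exp (- \<alpha> * s) / s ^ m * (exp (\<beta> * s) * (s ^ j / fact j)))
     \<longlongrightarrow> (if \<beta> = \<alpha> \<and> j = m then 1 / fact m else 0)) at_top"
proof (cases "\<beta> < \<alpha>")
  case True
  define d where "d = \<alpha> - \<beta>"
  have "0 < d"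
    using True by (simp add: d_def)
  have inv: "((\<lambda>s::real. inverse s ^ m) \<longlongrightarrow> 0 ^ m) at_top"
    by (intro tendsto_power tendsto_inverse_0_at_top filterlim_ident)
  have "filterlim (\<lambda>s. d * s) at_top at_top"
    by (rule filterlim_tendsto_pos_mult_at_top [OF tendsto_const \<open>0 < d\<close> filterlim_ident])
  then have "((\<lambda>s. (d * s) ^ j / exp (d * s)) \<longlongrightarrow> 0) at_top"
    by (rule filterlim_compose [OF tendsto_power_div_exp_0])
  then have "((\<lambda>s. (d * s) ^ j / exp (d * s) * inverse s ^ m * (1 / (d ^ j * fact j))) \<longlongrightarrow> 0 * 0 ^ m * (1 / (d ^ j * fact j))) at_top"
    by (intro tendsto_mult inv tendsto_const)
  moreover have "(d * s) ^ j / exp (d * s) * inverse s ^ m * (1 / (d ^ j * fact j))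
     = exp (- \<alpha> * s) / s ^ m * (exp (\<beta> * s) * (s ^ j / fact j))" for s
  proof -
    have "exp (- \<alpha> * s) * exp (\<beta> * s) = inverse (exp (d * s))"
      by (simp add: exp_minus [symmetric] exp_add [symmetric] d_def algebra_simps)
    then have "exp (- \<alpha> * s) / s ^ m * (exp (\<beta> * s) * (s ^ j / fact j)) = inverse (exp (d * s)) * (s ^ j / fact j) / s ^ m"
      by (metis (no_types, opaque_lifting) mult.assoc times_divide_eq_left)
    then show ?thesis
      using \<open>0 < d\<close> by (simp add: power_mult_distrib field_simps)
  qed
  ultimately show ?thesis
    using True by simp
next
  case False
  then have *: "\<beta> = \<alpha>" "j \<le> m"
    using assms by auto
  have "((\<lambda>s::real. inverse s ^ (m - j) * (1 / fact j)) \<longlongrightarrow> 0 ^ (m - j) * (1 / fact j)) at_top"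
    by (intro tendsto_mult tendsto_power tendsto_inverse_0_at_top filterlim_ident tendsto_const)
  moreover have "\<forall>\<^sub>F s in at_top. inverse s ^ (m - j) * (1 / fact j) = exp (- \<alpha> * s) / s ^ m * (exp (\<beta> * s) * (s ^ j / fact j))"
    using eventually_gt_at_top [of 0]
  proof eventually_elim
    case (elim s)
    have "s ^ m = s ^ (m - j) * s ^ j"
      using *(2) by (simp add: power_add [symmetric])
    with elim show ?case
      by (simp add: *(1) exp_minus field_simps)
  qed
  moreover have "(0::real) ^ (m - j) * (1 / fact j) = (if \<beta> = \<alpha> \<and> j = m then 1 / fact m else 0)"
    using * by auto
  ultimately show ?thesis
    using tendsto_cong by fastforce
qed

context jordan_data
begin

lemma sum_jbasis: "(\<Sum>b\<in>B. representation B v b *\<^sub>R b) = v"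
  by (rule sum_representation_eq) (simp_all add: independent_jbasis span_jbasis finite_jbasis)

lemma representation_sum_jbasis:
  assumes "b \<in> B"
  shows "representation B (\<Sum>b\<in>B. c b *\<^sub>R b) b = c b"
proof -
  have "representation B (\<Sum>b\<in>B. c b *\<^sub>R b) b = (\<Sum>b'\<in>B. c b' * representation B b' b)"
    by (simp add: representation_sum representation_scale independent_jbasis span_jbasis)
  also have "\<dots> = (\<Sum>b'\<in>B. if b' = b then c b' else 0)"
    using assms by (intro sum.cong) (auto simp: representation_basis independent_jbasis)
  finally show ?thesis
    using assms finite_jbasis by simp
qed

lemma continuous_representation: "continuous_on UNIV (\<lambda>v. representation B v b)"
  by (rule linear_continuous_on [OF bounded_linear_representation])

text \<open>Needed because the maximum in \<open>basis_norm\<close> is meaningful only over a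
  nonempty set.\<close>

lemma jbasis_nonempty: "B \<noteq> {}"
proof
  assume "B = {}"
  then have "axis undefined 1 = (0 :: real^'n)"
    using span_jbasis by auto
  then show False
    by (simp add: axis_eq_0_iff)
qed

lemma representation_le_basis_norm: "b \<in> B \<Longrightarrow> \<bar>representation B v b\<bar> \<le> basis_norm B v"
  unfolding basis_norm_def using finite_jbasis by (intro Max_ge) auto

lemma basis_norm_le: "(\<And>b. b \<in> B \<Longrightarrow> \<bar>representation B v b\<bar> \<le> x) \<Longrightarrow> basis_norm B v \<le> x"
  unfolding basis_norm_def using finite_jbasis jbasis_nonempty by (intro Max.boundedI) auto

sublocale expanding_flow flow "basis_norm B"
proof (rule expanding_flow.intro)
  show "linear (flow s)" for s
    by (rule linear_flow)
  show "flow s (flow t v) = flow (s + t) v" for s t v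
    by (rule flow_add)
  show "flow 0 v = v" for v
    by (rule flow_0)
  show "continuous_on UNIV (\<lambda>s. flow s v)" for v
    by (rule continuous_flow)
  show "\<exists>C c. 0 < c \<and> (\<forall>s\<ge>0. \<forall>v. norm (flow (- s) v) \<le> C * exp (- c * s) * norm v)"
    by (rule flow_contracting)
  show nonneg: "0 \<le> basis_norm B v" for v
    using jbasis_nonempty representation_le_basis_norm [of _ v] abs_ge_zero order_trans by blast
  show "basis_norm B (v + w) \<le> basis_norm B v + basis_norm B w" for v w
    using representation_le_basis_norm
    by (intro basis_norm_le) (auto simp: representation_jbasis intro: order_trans [OF abs_triangle_ineq add_mono])
  show "basis_norm B (a *\<^sub>R v) \<le> \<bar>a\<bar> * basis_norm B v" for a v
    using representation_le_basis_norm
    by (intro basis_norm_le) (auto simp: representation_jbasis abs_mult intro: mult_left_mono)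
  have "\<exists>R. 0 < R \<and> (\<forall>v. norm (representation B v b) \<le> norm v * R)" for b
    using bounded_linear.pos_bounded [OF bounded_linear_representation] by blast
  then obtain R where R: "0 < R b" "\<bar>representation B v b\<bar> \<le> norm v * R b" for v b
    by (metis real_norm_def)
  show "\<exists>c>0. \<forall>v. basis_norm B v \<le> c * norm v"
  proof (intro exI conjI allI)
    show "0 < (\<Sum>b\<in>B. R b)"
      using R(1) finite_jbasis jbasis_nonempty by (intro sum_pos) auto
    show "basis_norm B v \<le> (\<Sum>b\<in>B. R b) * norm v" for v
    proof (rule basis_norm_le)
      fix b assume "b \<in> B"
      then have "R b \<le> (\<Sum>b\<in>B. R b)"
        using R(1) finite_jbasis by (intro member_le_sum) (auto intro: less_imp_le)
      then have "norm v * R b \<le> norm v * (\<Sum>b\<in>B. R b)"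
        by (intro mult_left_mono) auto
      then show "\<bar>representation B v b\<bar> \<le> (\<Sum>b\<in>B. R b) * norm v"
        using R(2) [of v b] by (simp add: mult.commute)
    qed
  qed
  show "\<exists>c>0. \<forall>v. norm v \<le> c * basis_norm B v"
  proof (intro exI conjI allI)
    show "0 < (\<Sum>b\<in>B. norm b) + 1"
      by (intro add_nonneg_pos sum_nonneg) auto
    fix v
    have "norm v = norm (\<Sum>b\<in>B. representation B v b *\<^sub>R b)"
      by (simp add: sum_jbasis)
    also have "\<dots> \<le> (\<Sum>b\<in>B. basis_norm B v * norm b)"
      by (rule sum_norm_le) (auto intro: mult_right_mono representation_le_basis_norm)
    also have "\<dots> = (\<Sum>b\<in>B. norm b) * basis_norm B v"
      unfolding sum_distrib_left [symmetric] by (rule mult.commute)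
    also have "\<dots> \<le> ((\<Sum>b\<in>B. norm b) + 1) * basis_norm B v"
      using nonneg by (intro mult_right_mono) auto
    finally show "norm v \<le> ((\<Sum>b\<in>B. norm b) + 1) * basis_norm B v" .
  qed
qed

lemma D_M_eq_gauge: "D_M A B = gauge"
  by (simp add: fun_eq_iff D_M_def gauge_def flow_def)

text \<open>Despite the name this is the reciprocal of a growth rate: multiplying by it normalizes
  the flow on the block of level \<open>l\<close> at \<alpha>.\<close>

definition growth :: "real \<times> nat \<Rightarrow> real \<Rightarrow> real" where
  "growth = (\<lambda>(\<alpha>, l) s. exp (- \<alpha> * s) / s ^ (l - 1))"

text \<open>On \<open>b\<close> the flow is an exponential times a polynomial in \<open>s\<close>
  whose degree is the level minus 1 and whose leading coefficient is, up to a factorial, the end of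
  the chain of \<open>b\<close>. Normalized at \<open>p\<close>, only this coefficient can survive,
  and only for q = p.\<close>

lemma growth_flow_tendsto:
  assumes q: "q \<in> jpairs A S" "b \<in> jlevel A S q" and p: "p \<in> jpairs A S" "q = p \<or> pair_less q p"
  shows "((\<lambda>s. growth p s *\<^sub>R flow s b) \<longlongrightarrow>
    (if q = p then (1 / fact (snd p - 1)) *\<^sub>R N (fst p) (snd p - 1) b else 0)) at_top"
proof -
  obtain \<alpha> l \<beta> k where pq: "p = (\<alpha>, l)" "q = (\<beta>, k)"
    by (metis surj_pair)
  have lk: "1 \<le> l" "1 \<le> k"
    using jpairsD q(1) p(1) by (auto simp: pq)
  have le: "\<beta> < \<alpha> \<or> \<beta> = \<alpha> \<and> j \<le> l - 1" if "j < k" for j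
    using p(2) that lk by (auto simp: pq pair_less_def)
  have Nb: "N \<beta> k b = 0"
    using jlevelD(2) q(2) by (simp add: pq)
  let ?c = "\<lambda>j s. exp (- \<alpha> * s) / s ^ (l - 1) * (exp (\<beta> * s) * (s ^ j / fact j))"
  have "((\<lambda>s. \<Sum>j<k. ?c j s *\<^sub>R N \<beta> j b) \<longlongrightarrow> (\<Sum>j<k. (if \<beta> = \<alpha> \<and> j = l - 1 then 1 / fact (l - 1) else 0) *\<^sub>R N \<beta> j b)) at_top"
    by (intro tendsto_sum tendsto_scaleR tendsto_const growth_coefficient_tendsto le) simp
  moreover have "(\<Sum>j<k. ?c j s *\<^sub>R N \<beta> j b) = growth p s *\<^sub>R flow s b" for s
    by (simp add: growth_def pq flow_gen_eig [OF Nb] exp_partial_def scaleR_sum_right)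
  moreover have "(\<Sum>j<k. (if \<beta> = \<alpha> \<and> j = l - 1 then 1 / fact (l - 1) else 0) *\<^sub>R N \<beta> j b)
     = (if q = p then (1 / fact (snd p - 1)) *\<^sub>R N (fst p) (snd p - 1) b else 0)"
  proof (cases "q = p")
    case True
    then have "(\<Sum>j<k. (if \<beta> = \<alpha> \<and> j = l - 1 then 1 / fact (l - 1) else 0) *\<^sub>R N \<beta> j b)
       = (\<Sum>j\<in>{l - 1}. (1 / fact (l - 1)) *\<^sub>R N \<beta> j b)"
      using lk by (intro sum.mono_neutral_cong_right) (auto simp: pq)
    with True show ?thesis
      by (simp add: pq)
  next
    case False
    then have "(if \<beta> = \<alpha> \<and> j = l - 1 then 1 / fact (l - 1) else 0) *\<^sub>R N \<beta> j b = 0" if "j < k" for j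
      using p(2) that lk by (auto simp: pq pair_less_def)
    then have "(\<Sum>j<k. (if \<beta> = \<alpha> \<and> j = l - 1 then 1 / fact (l - 1) else 0) *\<^sub>R N \<beta> j b) = 0"
      by (intro sum.neutral ballI) (simp only: lessThan_iff)
    with False show ?thesis
      by (simp only: if_False)
  qed
  ultimately show ?thesis
    by (simp only:)
qed

text \<open>The leading coefficient of the flow on the block of \<open>p\<close>, without its
  factorial.\<close>

definition top_part :: "real \<times> nat \<Rightarrow> real^'n \<Rightarrow> real^'n" where
  "top_part p v = (\<Sum>b\<in>jlevel A S p. representation B v b *\<^sub>R N (fst p) (snd p - 1) b)"

definition up_to :: "real \<times> nat \<Rightarrow> real^'n \<Rightarrow> bool" where
  "up_to p v \<longleftrightarrow> (\<forall>q\<in>jpairs A S. \<forall>b\<in>jlevel A S q. representation B v b \<noteq> 0 \<longrightarrow> q = p \<or> pair_less q p)"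

lemma growth_flow_up_to_tendsto:
  assumes p: "p \<in> jpairs A S" and v: "up_to p v"
  shows "((\<lambda>s. growth p s *\<^sub>R flow s v) \<longlongrightarrow> (1 / fact (snd p - 1)) *\<^sub>R top_part p v) at_top"
proof -
  let ?L = "\<lambda>b. if b \<in> jlevel A S p then (1 / fact (snd p - 1)) *\<^sub>R N (fst p) (snd p - 1) b else 0"
  have "((\<lambda>s. representation B v b *\<^sub>R (growth p s *\<^sub>R flow s b)) \<longlongrightarrow> representation B v b *\<^sub>R ?L b) at_top"
    if b: "b \<in> B" for b
  proof (cases "representation B v b = 0")
    case False
    obtain q where q: "q \<in> jpairs A S" "b \<in> jlevel A S q"
      using b unfolding jbasis_def by blast
    then have "q = p \<or> pair_less q p"
      using v False by (auto simp: up_to_def)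
    moreover have "b \<in> jlevel A S p \<longleftrightarrow> q = p"
      using jlevel_unique p q by blast
    ultimately show ?thesis
      using growth_flow_tendsto [OF q p] by (intro tendsto_scaleR tendsto_const) simp
  qed simp
  then have "((\<lambda>s. \<Sum>b\<in>B. representation B v b *\<^sub>R (growth p s *\<^sub>R flow s b)) \<longlongrightarrow> (\<Sum>b\<in>B. representation B v b *\<^sub>R ?L b)) at_top"
    by (rule tendsto_sum)
  moreover have "(\<Sum>b\<in>B. representation B v b *\<^sub>R (growth p s *\<^sub>R flow s b)) = growth p s *\<^sub>R flow s v" for s
  proof -
    have "flow s v = (\<Sum>b\<in>B. representation B v b *\<^sub>R flow s b)"
      by (subst sum_jbasis [of v, symmetric]) (simp only: linear_sum [OF linear_flow] linear_scale [OF linear_flow])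
    then show ?thesis
      by (simp add: scaleR_sum_right mult.commute)
  qed
  moreover have "(\<Sum>b\<in>B. representation B v b *\<^sub>R ?L b) = (1 / fact (snd p - 1)) *\<^sub>R top_part p v"
    unfolding top_part_def scaleR_sum_right
    using finite_jbasis jlevel_subset [OF p] by (intro sum.mono_neutral_cong_right) auto
  ultimately show ?thesis
    by (simp only:)
qed

text \<open>The constant 1 is the flow rate with exponent 0 and degree 0, and every eigenvalue
  exceeds 0.\<close>

lemma growth_tendsto_0:
  assumes "p \<in> jpairs A S"
  shows "(growth p \<longlongrightarrow> 0) at_top"
proof -
  obtain \<alpha> l where p: "p = (\<alpha>, l)"
    by (metis surj_pair)
  have "0 < \<alpha>"
    using assms jpairsD(1) eigenvalue_pos by (auto simp: p)
  then show ?thesis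
    using growth_coefficient_tendsto [of 0 \<alpha> 0 "l - 1"] by (simp add: growth_def p fun_eq_iff)
qed

text \<open>The hypothesis is multiplied by \<open>growth p s\<close> and passed to the limit; the
  additive 1 drops out and the factorials cancel.\<close>

lemma basis_norm_top_part_le:
  assumes p: "p \<in> jpairs A S"
    and v: "up_to p v" and w: "up_to p w"
    and C: "\<And>s. basis_norm B (flow s w) \<le> C * (1 + basis_norm B (flow s v))"
  shows "basis_norm B (top_part p w) \<le> C * basis_norm B (top_part p v)"
proof -
  let ?f = "1 / fact (snd p - 1) :: real"
  have lim: "((\<lambda>s. basis_norm B (growth p s *\<^sub>R flow s x)) \<longlongrightarrow> ?f * basis_norm B (top_part p x)) at_top"
    if "up_to p x" for x
  proof -
    have "isCont (basis_norm B) y" for y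
      using continuous_\<nu> by (simp add: continuous_on_eq_continuous_at)
    then have "((\<lambda>s. basis_norm B (growth p s *\<^sub>R flow s x)) \<longlongrightarrow> basis_norm B (?f *\<^sub>R top_part p x)) at_top"
      using growth_flow_up_to_tendsto [OF p that] by (rule isCont_tendsto_compose)
    then show ?thesis
      by (simp add: \<nu>_scale)
  qed
  have "((\<lambda>s. C * (growth p s + basis_norm B (growth p s *\<^sub>R flow s v))) \<longlongrightarrow> C * (0 + ?f * basis_norm B (top_part p v))) at_top"
    by (intro tendsto_mult tendsto_add tendsto_const growth_tendsto_0 lim p v)
  moreover have "\<forall>\<^sub>F s in at_top. basis_norm B (growth p s *\<^sub>R flow s w) \<le> C * (growth p s + basis_norm B (growth p s *\<^sub>R flow s v))"
    using eventually_gt_at_top [of 0]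
  proof eventually_elim
    case (elim s)
    then have g: "0 \<le> growth p s"
      by (simp add: growth_def split_beta)
    then show ?case
      using mult_left_mono [OF C [of s] g] by (simp add: \<nu>_scale algebra_simps)
  qed
  ultimately have "?f * basis_norm B (top_part p w) \<le> C * (0 + ?f * basis_norm B (top_part p v))"
    using lim [OF w] by (intro tendsto_le [OF trivial_limit_at_top_linorder])
  then show ?thesis
    by (simp add: field_simps)
qed

text \<open>The block is mapped injectively into the basis, so its coordinates in \<open>v\<close>
  reappear unchanged as coordinates of \<open>top_part p v\<close>.\<close>

lemma coordinate_le_top_part:
  assumes p: "p \<in> jpairs A S" and b: "b \<in> jlevel A S p"
  shows "\<bar>representation B v b\<bar> \<le> basis_norm B (top_part p v)"
proof -
  define T where "T = N (fst p) (snd p - 1)"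
  have inj: "inj_on T (jlevel A S p)" and TB: "\<And>b. b \<in> jlevel A S p \<Longrightarrow> T b \<in> B"
    using jlevel_top_inj [of "fst p" "snd p"] jlevel_top_in_jbasis [of "fst p" "snd p"] p by (simp_all add: T_def)
  have fin: "finite (jlevel A S p)"
    using finite_subset [OF jlevel_subset [OF p] finite_jbasis] .
  have "representation B (top_part p v) (T b) = (\<Sum>b'\<in>jlevel A S p. representation B v b' * representation B (T b') (T b))"
    by (simp add: top_part_def representation_sum representation_scale independent_jbasis span_jbasis T_def)
  also have "\<dots> = (\<Sum>b'\<in>jlevel A S p. if b' = b then representation B v b' else 0)"
    using b TB inj by (intro sum.cong) (auto simp: representation_basis independent_jbasis dest: inj_onD)
  also have "\<dots> = representation B v b"
    using b fin by simp
  finally show ?thesis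
    using representation_le_basis_norm [OF TB [OF b], of "top_part p v"] by simp
qed

lemma top_part_le_coordinates:
  assumes p: "p \<in> jpairs A S"
  shows "basis_norm B (top_part p v) \<le> (\<Sum>b\<in>jlevel A S p. \<bar>representation B v b\<bar>)"
proof -
  have 1: "basis_norm B x \<le> 1" if "x \<in> B" for x
    using that by (intro basis_norm_le) (simp add: representation_basis independent_jbasis)
  have "basis_norm B (top_part p v) \<le> (\<Sum>b\<in>jlevel A S p. \<bar>representation B v b\<bar> * basis_norm B (N (fst p) (snd p - 1) b))"
    unfolding top_part_def by (rule order_trans [OF \<nu>_sum]) (simp add: \<nu>_scale)
  also have "\<dots> \<le> (\<Sum>b\<in>jlevel A S p. \<bar>representation B v b\<bar> * 1)"
    using jlevel_top_in_jbasis [of "fst p" "snd p"] p by (intro sum_mono mult_left_mono 1) auto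
  finally show ?thesis
    by simp
qed

lemma coordinate_comparison:
  assumes "p \<in> jpairs A S" "up_to p v" "up_to p w" "0 \<le> C"
    and "\<And>s. basis_norm B (flow s w) \<le> C * (1 + basis_norm B (flow s v))"
    and "b \<in> jlevel A S p"
  shows "\<bar>representation B w b\<bar> \<le> C * (\<Sum>b\<in>jlevel A S p. \<bar>representation B v b\<bar>)"
  using coordinate_le_top_part [OF assms(1,6), of w] basis_norm_top_part_le [OF assms(1,2,3,5)]
    mult_left_mono [OF top_part_le_coordinates [OF assms(1), of v] assms(4)] by linarith

end

section \<open>Comparison of coordinates block by block\<close>

locale numbered_jordan_data = jordan_data A S
  for A :: "real^'n^'n" and S :: "real \<Rightarrow> ((real^'n) \<times> nat) set" +
  fixes r :: nat and \<pi> :: "nat \<Rightarrow> real \<times> nat"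
  assumes numbering: "ascending_numbering (jpairs A S) r \<pi>"
begin

abbreviation blk :: "nat \<Rightarrow> (real^'n) set" where "blk i \<equiv> jlevel A S (\<pi> i)"
abbreviation later :: "nat \<Rightarrow> (real^'n) set" where "later i \<equiv> \<Union>j\<in>{i<..r}. blk j"

lemma \<pi>_in_jpairs: "i \<in> {1..r} \<Longrightarrow> \<pi> i \<in> jpairs A S"
  using numbering by (auto simp: ascending_numbering_def bij_betw_def)

lemma jpairsE:
  assumes "q \<in> jpairs A S"
  obtains i where "i \<in> {1..r}" "q = \<pi> i"
proof -
  have "q \<in> \<pi> ` {1..r}"
    using numbering assms by (simp add: ascending_numbering_def bij_betw_def)
  with that show thesis
    by blast
qed

lemma laterI: "i < j \<Longrightarrow> j \<in> {1..r} \<Longrightarrow> b \<in> blk j \<Longrightarrow> b \<in> later i"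
  by auto

lemma laterE:
  assumes "b \<in> later i" "i \<in> {1..r}"
  obtains j where "i < j" "j \<in> {1..r}" "b \<in> blk j"
  using assms by auto

lemma \<pi>_less: "i \<in> {1..r} \<Longrightarrow> j \<in> {1..r} \<Longrightarrow> i < j \<Longrightarrow> pair_less (\<pi> i) (\<pi> j)"
  using numbering by (auto simp: ascending_numbering_def)

lemma blk_disjoint:
  assumes "i \<in> {1..r}" "j \<in> {1..r}" "b \<in> blk i" "b \<in> blk j"
  shows "i = j"
proof -
  have "inj_on \<pi> {1..r}"
    using numbering by (simp add: ascending_numbering_def bij_betw_def)
  moreover have "\<pi> i = \<pi> j"
    by (rule jlevel_unique [OF \<pi>_in_jpairs \<pi>_in_jpairs assms(3,4)]) (rule assms)+
  ultimately show ?thesis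
    using assms(1,2) by (rule inj_onD)
qed

lemma blk_subset: "i \<in> {1..r} \<Longrightarrow> blk i \<subseteq> B"
  using jlevel_subset \<pi>_in_jpairs by blast

lemma finite_blk: "i \<in> {1..r} \<Longrightarrow> finite (blk i)"
  using finite_subset blk_subset finite_jbasis by blast

lemma later_subset:
  assumes "i \<in> {1..r}"
  shows "later i \<subseteq> B"
proof
  fix b assume "b \<in> later i"
  then obtain j where "j \<in> {1..r}" "b \<in> blk j"
    using laterE assms by blast
  then show "b \<in> B"
    using blk_subset by blast
qed

lemma up_toI:
  assumes i: "i \<in> {1..r}" and zero: "\<And>b. b \<in> later i \<Longrightarrow> representation B v b = 0"
  shows "up_to (\<pi> i) v"
  unfolding up_to_def
proof (intro ballI impI)
  fix q b assume q: "q \<in> jpairs A S" "b \<in> jlevel A S q" "representation B v b \<noteq> 0"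
  obtain j where j: "j \<in> {1..r}" "q = \<pi> j"
    using jpairsE q(1) .
  have "\<not> i < j"
    using q(2,3) j zero [OF laterI] by blast
  then consider "j = i" | "j < i"
    by linarith
  then show "q = \<pi> i \<or> pair_less q (\<pi> i)"
    using \<pi>_less i j by cases auto
qed

text \<open>If \<open>w\<close> reached beyond block \<open>i\<close>, then at its last such block
  it would grow at that block's rate, whereas \<open>v\<close> has no coordinate there to account
  for such growth.\<close>

lemma later_coordinates_vanish:
  assumes i: "i \<in> {1..r}" and v: "\<And>b. b \<in> later i \<Longrightarrow> representation B v b = 0"
    and C: "0 \<le> C" "\<And>s. basis_norm B (flow s w) \<le> C * (1 + basis_norm B (flow s v))"
    and b: "b \<in> later i"
  shows "representation B w b = 0"
proof (rule ccontr)
  assume nz: "representation B w b \<noteq> 0"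
  define J where "J = {j \<in> {i<..r}. \<exists>b\<in>blk j. representation B w b \<noteq> 0}"
  have "finite J" "J \<noteq> {}"
    using b nz by (auto simp: J_def)
  define j where "j = Max J"
  have "j \<in> J"
    unfolding j_def using \<open>finite J\<close> \<open>J \<noteq> {}\<close> by (rule Max_in)
  then obtain b' where j: "i < j" "j \<in> {1..r}" and b': "b' \<in> blk j" "representation B w b' \<noteq> 0"
    using i by (auto simp: J_def)
  have max: "k \<le> j" if "k \<in> J" for k
    unfolding j_def using \<open>finite J\<close> that by (rule Max_ge)
  have "up_to (\<pi> j) v"
    using v [OF laterI] j laterE by (intro up_toI j) (metis order_less_trans)
  moreover have "up_to (\<pi> j) w"
  proof (rule up_toI [OF j(2)])
    fix x assume "x \<in> later j"
    then obtain k where "j < k" "k \<in> {1..r}" "x \<in> blk k"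
      using laterE j(2) by blast
    with max [of k] j(1) show "representation B w x = 0"
      by (force simp: J_def)
  qed
  ultimately have "\<bar>representation B w b'\<bar> \<le> C * (\<Sum>b\<in>blk j. \<bar>representation B v b\<bar>)"
    by (intro coordinate_comparison \<pi>_in_jpairs j C b')
  also have "(\<Sum>b\<in>blk j. \<bar>representation B v b\<bar>) = 0"
    using v [OF laterI [OF j]] by (intro sum.neutral) simp
  finally show False
    using b'(2) by simp
qed

lemma block_coordinate_comparison:
  assumes i: "i \<in> {1..r}" and v: "\<And>b. b \<in> later i \<Longrightarrow> representation B v b = 0"
    and C: "0 \<le> C" "\<And>s. basis_norm B (flow s w) \<le> C * (1 + basis_norm B (flow s v))"
    and b: "b \<in> blk i"
  shows "\<bar>representation B w b\<bar> \<le> C * (\<Sum>b\<in>blk i. \<bar>representation B v b\<bar>)"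
  using later_coordinates_vanish [OF i v C] v
  by (intro coordinate_comparison \<pi>_in_jpairs i up_toI C b) auto

text \<open>One factor \<open>card B\<close> comes from summing the coordinatewise bounds for
  \<open>w\<close>, the other from bounding the sum of absolute values for \<open>v\<close> by its
  Euclidean norm. The size of the whole basis replaces that of the block, which makes the constant
  independent of \<open>i\<close>.\<close>

lemma block_L2_comparison:
  assumes i: "i \<in> {1..r}" and v: "\<And>b. b \<in> later i \<Longrightarrow> representation B v b = 0"
    and C: "0 \<le> C" "\<And>s. basis_norm B (flow s w) \<le> C * (1 + basis_norm B (flow s v))"
  shows "L2_set (representation B w) (blk i) \<le> real (card B) * C * real (card B) * L2_set (representation B v) (blk i)"
proof -
  let ?x = "\<Sum>b\<in>blk i. \<bar>representation B v b\<bar>"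
  let ?n = "real (card B)"
  have card: "real (card (blk i)) \<le> ?n"
    using card_mono [OF finite_jbasis blk_subset [OF i]] by simp
  have "?x \<le> real (card (blk i)) * L2_set (representation B v) (blk i)"
  proof (rule sum_bounded_above)
    fix b assume "b \<in> blk i"
    then have "\<bar>representation B v b\<bar> \<le> L2_set (\<lambda>b. \<bar>representation B v b\<bar>) (blk i)"
      using member_le_L2_set [OF finite_blk [OF i], of b "\<lambda>b. \<bar>representation B v b\<bar>"] by simp
    then show "\<bar>representation B v b\<bar> \<le> L2_set (representation B v) (blk i)"
      by (simp add: L2_set_def)
  qed
  also have "\<dots> \<le> ?n * L2_set (representation B v) (blk i)"
    using card by (intro mult_right_mono L2_set_nonneg)
  finally have x: "?x \<le> ?n * L2_set (representation B v) (blk i)" .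
  have "L2_set (representation B w) (blk i) \<le> (\<Sum>b\<in>blk i. \<bar>representation B w b\<bar>)"
    by (rule L2_set_le_sum_abs)
  also have "\<dots> \<le> real (card (blk i)) * (C * ?x)"
    by (rule sum_bounded_above) (rule block_coordinate_comparison [OF i v C])
  also have "\<dots> \<le> ?n * (C * ?x)"
    using card C(1) by (intro mult_right_mono mult_nonneg_nonneg sum_nonneg) auto
  also have "\<dots> \<le> ?n * (C * (?n * L2_set (representation B v) (blk i)))"
    using x C(1) by (intro mult_left_mono) auto
  finally show ?thesis
    by (simp only: mult.assoc)
qed

text \<open>A right inverse to taking the coordinates of block \<open>i\<close> and of the later
  blocks. Earlier coordinates are set to 0, a choice that does not influence block \<open>i\<close>
  of the image under a map as in \<open>bilip_block_form\<close>.\<close>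

definition point :: "nat \<Rightarrow> (real^'n \<Rightarrow> real) \<Rightarrow> (real^'n \<Rightarrow> real) \<Rightarrow> real^'n" where
  "point i x y = (\<Sum>b\<in>B. (if b \<in> blk i then x b else if b \<in> later i then y b else 0) *\<^sub>R b)"

lemma representation_point:
  assumes "i \<in> {1..r}"
  shows "b \<in> blk i \<Longrightarrow> representation B (point i x y) b = x b"
    and "b \<in> later i \<Longrightarrow> representation B (point i x y) b = y b"
proof -
  show "representation B (point i x y) b = x b" if "b \<in> blk i"
    unfolding point_def using that blk_subset [OF assms]
    by (subst representation_sum_jbasis) auto
  show "representation B (point i x y) b = y b" if "b \<in> later i"
  proof -
    have "b \<notin> blk i"
      using blk_disjoint [OF assms] laterE [OF that assms] by (metis less_irrefl)
    then show ?thesis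
      unfolding point_def using that later_subset [OF assms]
      by (subst representation_sum_jbasis) auto
  qed
qed

lemma continuous_on_point: "continuous_on X (\<lambda>y. point i x y)"
proof -
  have "continuous_on X (\<lambda>y. if b \<in> blk i then x b else if b \<in> later i then y b else 0)" for b
    by (cases "b \<in> blk i"; cases "b \<in> later i")
      (simp_all only: if_True if_False continuous_on_const continuous_on_subset [OF continuous_on_product_coordinates subset_UNIV])
  then show ?thesis
    unfolding point_def by (intro continuous_on_sum continuous_on_scaleR continuous_on_const)
qed

lemma eucl_dist_coords:
  "eucl_dist (blk i) (coords B (blk i) v) (coords B (blk i) w) = L2_set (representation B (v - w)) (blk i)"
  unfolding eucl_dist_def by (rule L2_set_cong) (simp_all add: coords_def representation_jbasis)

lemma eucl_dist_point:
  assumes "i \<in> {1..r}"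
  shows "eucl_dist (blk i) x x' = L2_set (representation B (point i x y - point i x' y)) (blk i)"
  unfolding eucl_dist_def
  by (rule L2_set_cong) (simp_all add: representation_jbasis representation_point(1) [OF assms])

lemma bilip_block_form:
  assumes "bilip (D_M A B) (D_M A B) UNIV F K"
  shows "\<exists>f :: nat \<Rightarrow> (real^'n \<Rightarrow> real) \<Rightarrow> (real^'n \<Rightarrow> real) \<Rightarrow> (real^'n \<Rightarrow> real).
    (\<forall>u. \<forall>i\<in>{1..r}.
       coords B (blk i) (F u) = f i (coords B (blk i) u) (coords B (later i) u)) \<and>
    (\<forall>i\<in>{1..r}. \<exists>L. \<forall>y \<in> later i \<rightarrow>\<^sub>E UNIV.
       bilip (eucl_dist (blk i)) (eucl_dist (blk i)) (blk i \<rightarrow>\<^sub>E UNIV) (\<lambda>x. f i x y) L) \<and>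
    (\<forall>i\<in>{1..r}. \<forall>x \<in> blk i \<rightarrow>\<^sub>E UNIV.
       continuous_on (later i \<rightarrow>\<^sub>E UNIV) (\<lambda>y. f i x y))"
proof -
  have "0 < K" and up: "\<And>p q. gauge (F p) (F q) \<le> K * gauge p q"
    and low: "\<And>p q. gauge p q \<le> K * gauge (F p) (F q)"
    using assms by (auto simp: bilip_def D_M_eq_gauge field_simps)
  have bij: "bij F"
    using bilipschitz_imp_bij [OF \<open>0 < K\<close> up low] .
  define G where "G = inv F"
  have GF: "G (F p) = p" for p
    using bij by (simp add: G_def bij_is_inj)
  have FG: "F (G p) = p" for p
    using bij by (simp add: G_def bij_is_surj surj_f_inv_f)
  have upG: "gauge (G p) (G q) \<le> K * gauge p q" for p q
    using low [of "G p" "G q"] by (simp add: FG)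
  obtain C1 where C1: "0 < C1" "\<And>t p q. basis_norm B (flow (- t) (F p - F q)) \<le> C1 * (1 + basis_norm B (flow (- t) (p - q)))"
    using lipschitz_every_scale [of K F, OF \<open>0 < K\<close> up] by blast
  obtain C2 where C2: "0 < C2" "\<And>t p q. basis_norm B (flow (- t) (G p - G q)) \<le> C2 * (1 + basis_norm B (flow (- t) (p - q)))"
    using lipschitz_every_scale [of K G, OF \<open>0 < K\<close> upG] by blast
  have F: "basis_norm B (flow s (F p - F q)) \<le> C1 * (1 + basis_norm B (flow s (p - q)))" for s p q
    using C1(2) [of "- s" p q] by simp
  \<comment> \<open>The bound for the inverse, taken at \<open>F p\<close> and \<open>F q\<close>,
    is a lower bound for \<open>F\<close>: the comparison applies with \<open>p - q\<close> and
    \<open>F p - F q\<close> exchanged.\<close>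
  have G: "basis_norm B (flow s (p - q)) \<le> C2 * (1 + basis_norm B (flow s (F p - F q)))" for s p q
    using C2(2) [of "- s" "F p" "F q"] by (simp add: GF)
  have cont: "continuous_on UNIV F"
    using lipschitz_imp_continuous [OF \<open>0 < K\<close> up] .
  define f where "f i x y = coords B (blk i) (F (point i x y))" for i x y
  show ?thesis
  proof (intro exI [of _ f] conjI allI ballI)
    fix u i assume i: "i \<in> {1..r}"
    let ?p = "point i (coords B (blk i) u) (coords B (later i) u)"
    have blk0: "representation B (u - ?p) b = 0" if "b \<in> blk i" for b
      using that by (simp add: representation_jbasis representation_point(1) [OF i] coords_def)
    have later0: "representation B (u - ?p) b = 0" if "b \<in> later i" for b
      using that by (simp add: representation_jbasis representation_point(2) [OF i that] coords_def)
    have "representation B (F u) b = representation B (F ?p) b" if "b \<in> blk i" for b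
    proof -
      \<comment> \<open>The points \<open>u\<close> and \<open>?p\<close> differ only in blocks
        before \<open>i\<close>, so the right-hand side is zero: this is the triangular
        form.\<close>
      have "\<bar>representation B (F u - F ?p) b\<bar> \<le> C1 * (\<Sum>b\<in>blk i. \<bar>representation B (u - ?p) b\<bar>)"
        by (rule block_coordinate_comparison [OF i later0 less_imp_le [OF C1(1)] F that])
      also have "(\<Sum>b\<in>blk i. \<bar>representation B (u - ?p) b\<bar>) = 0"
        by (intro sum.neutral ballI) (simp add: blk0)
      finally show ?thesis
        by (simp add: representation_jbasis)
    qed
    then show "coords B (blk i) (F u) = f i (coords B (blk i) u) (coords B (later i) u)"
      unfolding f_def coords_def by (intro restrict_ext) simp
  next
    fix i assume i: "i \<in> {1..r}"
    define n where "n = real (card B)"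
    \<comment> \<open>One constant serves both inequalities; the 1 makes it positive. It is fixed
      before \<open>y\<close>, so the bilipschitz bound is uniform in the later coordinates.\<close>
    define L where "L = 1 + n * C1 * n + n * C2 * n"
    have nn: "0 \<le> n * C1 * n" "0 \<le> n * C2 * n"
      using C1(1) C2(1) by (simp_all add: n_def)
    then have "0 < L"
      by (simp add: L_def)
    have "bilip (eucl_dist (blk i)) (eucl_dist (blk i)) (blk i \<rightarrow>\<^sub>E UNIV) (\<lambda>x. f i x y) L" for y
      unfolding bilip_def
    proof (intro conjI ballI)
      show "0 < L"
        by fact
      fix x x'
      let ?p = "point i x y" and ?q = "point i x' y"
      let ?d = "eucl_dist (blk i) x x'" and ?d' = "eucl_dist (blk i) (f i x y) (f i x' y)"
      have d: "?d = L2_set (representation B (?p - ?q)) (blk i)"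
        by (rule eucl_dist_point [OF i])
      have d': "?d' = L2_set (representation B (F ?p - F ?q)) (blk i)"
        unfolding f_def by (rule eucl_dist_coords)
      have later0: "representation B (?p - ?q) b = 0" if "b \<in> later i" for b
        by (simp add: representation_jbasis representation_point(2) [OF i that])
      \<comment> \<open>The images again agree in all later blocks, which is the condition for
        running the comparison backwards.\<close>
      have later0': "representation B (F ?p - F ?q) b = 0" if "b \<in> later i" for b
        by (rule later_coordinates_vanish [OF i later0 less_imp_le [OF C1(1)] F that])
      have "?d' \<le> n * C1 * n * ?d"
        unfolding d d' n_def by (rule block_L2_comparison [OF i later0 less_imp_le [OF C1(1)] F])
      also have "\<dots> \<le> L * ?d"
        using nn by (intro mult_right_mono) (auto simp: L_def d)
      finally show "?d' \<le> L * ?d" .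
      have "?d \<le> n * C2 * n * ?d'"
        unfolding d d' n_def by (rule block_L2_comparison [OF i later0' less_imp_le [OF C2(1)] G])
      also have "\<dots> \<le> L * ?d'"
        using nn by (intro mult_right_mono) (auto simp: L_def d')
      finally show "1 / L * ?d \<le> ?d'"
        using \<open>0 < L\<close> by (simp add: field_simps)
    qed
    then show "\<exists>L. \<forall>y \<in> later i \<rightarrow>\<^sub>E UNIV.
       bilip (eucl_dist (blk i)) (eucl_dist (blk i)) (blk i \<rightarrow>\<^sub>E UNIV) (\<lambda>x. f i x y) L"
      by blast
  next
    fix i x
    have "continuous_on X (\<lambda>y. representation B (F (point i x y)) b)" for X b
      by (rule continuous_on_compose2 [OF continuous_representation continuous_on_compose2 [OF cont continuous_on_point]]) auto
    \<comment> \<open>Outside the block the restricted function has the constant value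
      \<open>undefined\<close>, so those coordinates are continuous as well.\<close>
    then have "continuous_on X (\<lambda>y. f i x y b)" for X b
      by (cases "b \<in> blk i") (simp_all add: f_def coords_def)
    then show "continuous_on (later i \<rightarrow>\<^sub>E UNIV) (\<lambda>y. f i x y)"
      by (rule continuous_on_coordinatewise_then_product)
  qed
qed

end

theorem proposition1:
  fixes A :: "real^'n^'n"
    and S :: "real \<Rightarrow> ((real^'n) \<times> nat) set"
    and r :: nat and \<pi> :: "nat \<Rightarrow> real \<times> nat"
    and F :: "real^'n \<Rightarrow> real^'n"
  defines "B \<equiv> jbasis A S"
    and "blk \<equiv> \<lambda>i. jlevel A S (\<pi> i)"
    and "later \<equiv> \<lambda>i. \<Union>j\<in>{i<..r}. jlevel A S (\<pi> j)"
  assumes "\<And>\<mu>. eigenvalue (complexify A) \<mu> \<Longrightarrow> \<mu> \<in> \<real> \<and> 0 < Re \<mu>"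
    and "jordan_chains A S"
    and "ascending_numbering (jpairs A S) r \<pi>"
    and "\<exists>K. bilip (D_M A B) (D_M A B) UNIV F K"
  shows "\<exists>f :: nat \<Rightarrow> (real^'n \<Rightarrow> real) \<Rightarrow> (real^'n \<Rightarrow> real) \<Rightarrow> (real^'n \<Rightarrow> real).
    (\<forall>u. \<forall>i\<in>{1..r}.
       coords B (blk i) (F u) = f i (coords B (blk i) u) (coords B (later i) u)) \<and>
    (\<forall>i\<in>{1..r}. \<exists>L. \<forall>y \<in> later i \<rightarrow>\<^sub>E UNIV.
       bilip (eucl_dist (blk i)) (eucl_dist (blk i)) (blk i \<rightarrow>\<^sub>E UNIV) (\<lambda>x. f i x y) L) \<and>
    (\<forall>i\<in>{1..r}. \<forall>x \<in> blk i \<rightarrow>\<^sub>E UNIV.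
       continuous_on (later i \<rightarrow>\<^sub>E UNIV) (\<lambda>y. f i x y))"
proof -
  interpret numbered_jordan_data A S r \<pi>
    by unfold_locales (use assms in auto)
  obtain K where "bilip (D_M A B) (D_M A B) UNIV F K"
    using assms(7) by blast
  then show ?thesis
    unfolding B_def blk_def later_def by (rule bilip_block_form)
qed

end
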